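(* Let $S$ be an infinite set. Then the dual Banach algebra $\ell^2(S)$, with pointwise multiplication, is approximately Connes-biprojective but it is not Connes-biprojective.
   Context: $\ell^2(S)$ is the Banach algebra of square-summable complex functions on $S$ with pointwise multiplication; being a Hilbert space (reflexive), it is a dual Banach algebra, with predual $\ell^2(S)$ via $\langle x,y\rangle=\sum_{s\in S}x(s)y(s)$. A Banach algebra $\mathcal{A}$ is called a dual Banach algebra if there is a closed $\mathcal{A}$-submodule $\mathcal{A}_*$ of $\mathcal{A}^*$ such that $\mathcal{A}=(\mathcal{A}_* )^*$; the $wk^*$-topology on $\mathcal{A}$ is $\sigma(\mathcal{A},\mathcal{A}_* )$. For a Banach $\mathcal{A}$-bimodule $E$, the dual $E^*$ is a Banach $\mathcal{A}$-bimodule via $(a\cdot f)(x)=f(x\cdot a)$ and $(f\cdot a)(x)=f(a\cdot x)$. The projective tensor product $\mathcal{A}\hat{\otimes}\mathcal{A}$ is a Banach $\mathcal{A}$-bimodule via $a\cdot(b\otimes c)=ab\otimes c$, $(b\otimes c)\cdot a=b\otimes ca$, and $\pi_{\mathcal{A}}:\mathcal{A}\hat{\otimes}\mathcal{A}\to\mathcal{A}$ is the product morphism determined by $\pi_{\mathcal{A}}(a\otimes b)=ab$. For a Banach $\mathcal{A}$-bimodule $E$, $\sigma wc(E)$ denotes the set of all $x\in E$ such that the maps $\mathcal{A}\to E$, $a\mapsto a\cdot x$ and $a\mapsto x\cdot a$, are continuous from the $wk^*$-topology of $\mathcal{A}$ to the weak topology of $E$; it is a closed submodule of $E$. The notation $\sigma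 wc(\mathcal{A}\hat{\otimes}\mathcal{A})^*$ means $\sigma wc((\mathcal{A}\hat{\otimes}\mathcal{A})^* )$. Since $\sigma wc(\mathcal{A}_* )=\mathcal{A}_*$, the adjoint $\pi_{\mathcal{A}}^*$ maps $\mathcal{A}_*$ into $\sigma wc(\mathcal{A}\hat{\otimes}\mathcal{A})^*$, and $\pi_{\sigma wc}:(\sigma wc(\mathcal{A}\hat{\otimes}\mathcal{A})^* )^*\to\mathcal{A}=(\mathcal{A}_* )^*$ denotes the adjoint of $\pi_{\mathcal{A}}^*|_{\mathcal{A}_*}$; it is an $\mathcal{A}$-bimodule morphism. $\mathcal{A}$ is Connes-biprojective if there exists a bounded $\mathcal{A}$-bimodule morphism $\rho:\mathcal{A}\to(\sigma wc(\mathcal{A}\hat{\otimes}\mathcal{A})^* )^*$ such that $\pi_{\sigma wc}\circ\rho=id_{\mathcal{A}}$. $\mathcal{A}$ is approximately Connes-biprojective if there exists a (not necessarily bounded) net $(\rho_\alpha)$ of continuous $\mathcal{A}$-bimodule morphisms from $\mathcal{A}$ into $(\sigma wc(\mathcal{A}\hat{\otimes}\mathcal{A})^* )^*$ such that $\pi_{\sigma wc}\circ\rho_\alpha(a)\to a$ in norm for every $a\in\mathcal{A}$. *)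

theory Defs
  imports "HOL-Analysis.Analysis" "HOL-Library.Function_Algebras"
begin

section \<open>Complex vector spaces and normed spaces on carrier sets\<close>

class complex_vector = ab_group_add +
  fixes scaleC :: "complex \<Rightarrow> 'a \<Rightarrow> 'a"  (infixr \<open>*\<^sub>C\<close> 75)
  assumes scaleC_add_right: "c *\<^sub>C (x + y) = c *\<^sub>C x + c *\<^sub>C y"
    and scaleC_add_left: "(c + d) *\<^sub>C x = c *\<^sub>C x + d *\<^sub>C x"
    and scaleC_scaleC: "c *\<^sub>C d *\<^sub>C x = (c * d) *\<^sub>C x"
    and scaleC_one: "1 *\<^sub>C x = x"

global_interpretation complex_vector: vector_space "scaleC :: complex \<Rightarrow> 'a \<Rightarrow> 'a::complex_vector"
  by unfold_locales
    (simp_all add: scaleC_add_right scaleC_add_left scaleC_scaleC scaleC_one)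

instantiation complex :: complex_vector
begin
definition "scaleC_complex (c::complex) (z::complex) = c * z"
instance by standard (simp_all add: scaleC_complex_def algebra_simps)
end

instantiation "fun" :: (type, complex_vector) complex_vector
begin
definition "scaleC_fun c (f :: 'a \<Rightarrow> 'b) = (\<lambda>x. c *\<^sub>C f x)"
instance
  by standard (simp_all add: scaleC_fun_def fun_eq_iff
      scaleC_add_right scaleC_add_left scaleC_scaleC scaleC_one)
end

text \<open>A normed space is a linear subspace of an ambient complex vector space together with a
  norm on it.  Working with carrier sets instead of types lets us form duals of subspaces that
  depend on parameters, such as \<open>(\<sigma>wc(E))\<^sup>*\<close>.\<close>

record 'a nspace =
  carr :: "'a set"
  nrm :: "'a \<Rightarrow> real"

definition normed_space :: "('a::complex_vector, 'x) nspace_scheme \<Rightarrow> bool" where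
  "normed_space E \<longleftrightarrow>
     complex_vector.subspace (carr E) \<and>
     (\<forall>x\<in>carr E. 0 \<le> nrm E x \<and> (nrm E x = 0 \<longleftrightarrow> x = 0)) \<and>
     (\<forall>c. \<forall>x\<in>carr E. nrm E (c *\<^sub>C x) = cmod c * nrm E x) \<and>
     (\<forall>x\<in>carr E. \<forall>y\<in>carr E. nrm E (x + y) \<le> nrm E x + nrm E y)"

text \<open>The locale \<open>Metric_space\<close> asks for symmetry and nonnegativity on the whole type, so the
  distance is set to \<open>0\<close> off the carrier; topology and completeness do not depend on these
  values.\<close>

definition norm_dist :: "('a::complex_vector, 'x) nspace_scheme \<Rightarrow> 'a \<Rightarrow> 'a \<Rightarrow> real" where
  "norm_dist E x y = (if x \<in> carr E \<and> y \<in> carr E then nrm E (x - y) else 0)"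

lemma Metric_space_norm_dist:
  assumes "normed_space E"
  shows "Metric_space (carr E) (norm_dist E)"
proof
  have sub: "complex_vector.subspace (carr E)"
    and pos: "\<And>x. x \<in> carr E \<Longrightarrow> 0 \<le> nrm E x \<and> (nrm E x = 0 \<longleftrightarrow> x = 0)"
    and hom: "\<And>c x. x \<in> carr E \<Longrightarrow> nrm E (c *\<^sub>C x) = cmod c * nrm E x"
    and tri: "\<And>x y. x \<in> carr E \<Longrightarrow> y \<in> carr E \<Longrightarrow> nrm E (x + y) \<le> nrm E x + nrm E y"
    using assms unfolding normed_space_def by auto
  have diff: "x - y \<in> carr E" if "x \<in> carr E" "y \<in> carr E" for x y
    using complex_vector.subspace_diff[OF sub] that by blast
  show "0 \<le> norm_dist E x y" for x y
    using pos diff by (simp add: norm_dist_def)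
  have "nrm E (x - y) = nrm E (y - x)" if "x \<in> carr E" "y \<in> carr E" for x y
    using hom[OF diff[OF that], of "-1"] by simp
  then show "norm_dist E x y = norm_dist E y x" for x y
    by (simp add: norm_dist_def)
  show "norm_dist E x y = 0 \<longleftrightarrow> x = y" if "x \<in> carr E" "y \<in> carr E" for x y
    using that pos[OF diff[OF that]] by (simp add: norm_dist_def)
  show "norm_dist E x z \<le> norm_dist E x y + norm_dist E y z"
    if "x \<in> carr E" "y \<in> carr E" "z \<in> carr E" for x y z
    using tri[OF diff[OF that(1,2)] diff[OF that(2,3)]] that by (simp add: norm_dist_def)
qed

definition banach_space :: "('a::complex_vector, 'x) nspace_scheme \<Rightarrow> bool" where
  "banach_space E \<longleftrightarrow> normed_space E \<and> Metric_space.mcomplete (carr E) (norm_dist E)"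

definition norm_topology :: "('a::complex_vector, 'x) nspace_scheme \<Rightarrow> 'a topology" where
  "norm_topology E = Metric_space.mtopology (carr E) (norm_dist E)"

abbreviation complex_space :: "complex nspace" where
  "complex_space \<equiv> \<lparr>carr = UNIV, nrm = cmod\<rparr>"

definition linear_between ::
  "('a::complex_vector, 'x) nspace_scheme \<Rightarrow> ('b::complex_vector, 'y) nspace_scheme \<Rightarrow> ('a \<Rightarrow> 'b) \<Rightarrow> bool"
  where
  "linear_between E F T \<longleftrightarrow>
     T \<in> carr E \<rightarrow> carr F \<and>
     (\<forall>x\<in>carr E. \<forall>y\<in>carr E. T (x + y) = T x + T y) \<and>
     (\<forall>c. \<forall>x\<in>carr E. T (c *\<^sub>C x) = c *\<^sub>C T x)"

definition bounded_between ::
  "('a::complex_vector, 'x) nspace_scheme \<Rightarrow> ('b::complex_vector, 'y) nspace_scheme \<Rightarrow> ('a \<Rightarrow> 'b) \<Rightarrow> bool"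
  where
  "bounded_between E F T \<longleftrightarrow> (\<exists>K. \<forall>x\<in>carr E. nrm F (T x) \<le> K * nrm E x)"

text \<open>Members of \<open>bounded_ops E F\<close> are normalised to be \<open>0\<close> off the carrier, so that each
  bounded operator is represented by exactly one function and the vector space operations are
  the pointwise ones.\<close>

definition bounded_ops ::
  "('a::complex_vector, 'x) nspace_scheme \<Rightarrow> ('b::complex_vector, 'y) nspace_scheme \<Rightarrow> ('a \<Rightarrow> 'b) set"
  where
  "bounded_ops E F =
     {T. linear_between E F T \<and> bounded_between E F T \<and> (\<forall>x. x \<notin> carr E \<longrightarrow> T x = 0)}"

definition dual :: "('a::complex_vector, 'x) nspace_scheme \<Rightarrow> ('a \<Rightarrow> complex) nspace" where
  "dual E = \<lparr>carr = bounded_ops E complex_space,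
             nrm = (\<lambda>f. Sup {cmod (f x) | x. x \<in> carr E \<and> nrm E x \<le> 1})\<rparr>"

text \<open>The adjoint, on functionals, of a map \<open>T\<close> defined on \<open>E\<close>.\<close>

definition adjoint ::
  "('a, 'x) nspace_scheme \<Rightarrow> ('a \<Rightarrow> 'b) \<Rightarrow> ('b \<Rightarrow> complex) \<Rightarrow> 'a \<Rightarrow> complex" where
  "adjoint E T f = (\<lambda>x. if x \<in> carr E then f (T x) else 0)"

text \<open>The topology \<open>\<sigma>(X, P)\<close>: the coarsest topology on \<open>X\<close> making all functionals in \<open>P\<close>
  continuous.\<close>

definition weak_topology :: "'a set \<Rightarrow> ('a \<Rightarrow> complex) set \<Rightarrow> 'a topology" where
  "weak_topology X P =
     pullback_topology X (\<lambda>x. \<lambda>f\<in>P. f x) (product_topology (\<lambda>_. euclidean) P)"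


section \<open>Banach algebras and bimodules\<close>

record 'a nalgebra = "'a nspace" +
  mult :: "'a \<Rightarrow> 'a \<Rightarrow> 'a"

definition banach_algebra :: "('a::complex_vector, 'x) nalgebra_scheme \<Rightarrow> bool" where
  "banach_algebra A \<longleftrightarrow>
     banach_space A \<and>
     (\<forall>a\<in>carr A. linear_between A A (\<lambda>b. mult A a b)) \<and>
     (\<forall>b\<in>carr A. linear_between A A (\<lambda>a. mult A a b)) \<and>
     (\<forall>a\<in>carr A. \<forall>b\<in>carr A. \<forall>c\<in>carr A. mult A (mult A a b) c = mult A a (mult A b c)) \<and>
     (\<forall>a\<in>carr A. \<forall>b\<in>carr A. nrm A (mult A a b) \<le> nrm A a * nrm A b)"

record ('a, 'e) bimodule = "'e nspace" +
  lact :: "'a \<Rightarrow> 'e \<Rightarrow> 'e"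
  ract :: "'e \<Rightarrow> 'a \<Rightarrow> 'e"

definition algebra_bimodule :: "('a, 'x) nalgebra_scheme \<Rightarrow> ('a, 'a) bimodule" where
  "algebra_bimodule A = \<lparr>carr = carr A, nrm = nrm A, lact = mult A, ract = mult A\<rparr>"

definition dual_bimodule ::
  "('a, 'e::complex_vector, 'x) bimodule_scheme \<Rightarrow> ('a, 'e \<Rightarrow> complex) bimodule" where
  "dual_bimodule E =
     \<lparr>carr = carr (dual E), nrm = nrm (dual E),
      lact = (\<lambda>a f. \<lambda>x. if x \<in> carr E then f (ract E x a) else 0),
      ract = (\<lambda>f a. \<lambda>x. if x \<in> carr E then f (lact E a x) else 0)\<rparr>"

definition submodule ::
  "('a, 'x) nalgebra_scheme \<Rightarrow> ('a, 'e::complex_vector, 'y) bimodule_scheme \<Rightarrow> 'e set \<Rightarrow> bool" where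
  "submodule A E M \<longleftrightarrow>
     M \<subseteq> carr E \<and> complex_vector.subspace M \<and>
     (\<forall>a\<in>carr A. \<forall>x\<in>M. lact E a x \<in> M \<and> ract E x a \<in> M)"

definition bimodule_morphism ::
  "('a::complex_vector, 'x) nalgebra_scheme \<Rightarrow> ('a, 'e::complex_vector, 'y) bimodule_scheme \<Rightarrow>
   ('a, 'f::complex_vector, 'z) bimodule_scheme \<Rightarrow> ('e \<Rightarrow> 'f) \<Rightarrow> bool" where
  "bimodule_morphism A E F T \<longleftrightarrow>
     linear_between E F T \<and>
     (\<forall>a\<in>carr A. \<forall>x\<in>carr E. T (lact E a x) = lact F a (T x) \<and> T (ract E x a) = ract F (T x) a)"


section \<open>The projective tensor product\<close>

definition bilinear_forms ::
  "('e::complex_vector, 'x) nspace_scheme \<Rightarrow> ('f::complex_vector, 'y) nspace_scheme \<Rightarrow>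
   ('e \<Rightarrow> 'f \<Rightarrow> complex) set" where
  "bilinear_forms E F =
     {B. (\<forall>x\<in>carr E. linear_between F complex_space (\<lambda>y. B x y)) \<and>
         (\<forall>y\<in>carr F. linear_between E complex_space (\<lambda>x. B x y)) \<and>
         (\<exists>K. \<forall>x\<in>carr E. \<forall>y\<in>carr F. cmod (B x y) \<le> K * nrm E x * nrm F y)}"

text \<open>Tensors are realised as functionals on the bounded bilinear forms, the elementary tensor
  \<open>x \<otimes> y\<close> being evaluation at \<open>(x, y)\<close>.  The elements of the projective tensor product are the
  sums \<open>\<Sum>n. x n \<otimes> y n\<close> with \<open>\<Sum>n. \<parallel>x n\<parallel> \<parallel>y n\<parallel> < \<infinity>\<close>, normed by the infimum of
  \<open>\<Sum>n. \<parallel>x n\<parallel> \<parallel>y n\<parallel>\<close> over all such representations.  This is the completion of the algebraic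
  tensor product in the projective norm: bounded bilinear forms are exactly the dual of the
  completion, hence separate its points, and allowing infinite sums does not change the
  infimum on algebraic tensors.\<close>

definition elem_tensor ::
  "('e::complex_vector, 'x) nspace_scheme \<Rightarrow> ('f::complex_vector, 'y) nspace_scheme \<Rightarrow>
   'e \<Rightarrow> 'f \<Rightarrow> ('e \<Rightarrow> 'f \<Rightarrow> complex) \<Rightarrow> complex" where
  "elem_tensor E F x y = (\<lambda>B. if B \<in> bilinear_forms E F then B x y else 0)"

definition tensor_rep ::
  "('e::complex_vector, 'x) nspace_scheme \<Rightarrow> ('f::complex_vector, 'y) nspace_scheme \<Rightarrow>
   (('e \<Rightarrow> 'f \<Rightarrow> complex) \<Rightarrow> complex) \<Rightarrow> (nat \<Rightarrow> 'e) \<Rightarrow> (nat \<Rightarrow> 'f) \<Rightarrow> bool" where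
  "tensor_rep E F u x y \<longleftrightarrow>
     range x \<subseteq> carr E \<and> range y \<subseteq> carr F \<and>
     summable (\<lambda>n. nrm E (x n) * nrm F (y n)) \<and>
     u = (\<lambda>B. \<Sum>n. elem_tensor E F (x n) (y n) B)"

definition proj_tensor ::
  "('e::complex_vector, 'x) nspace_scheme \<Rightarrow> ('f::complex_vector, 'y) nspace_scheme \<Rightarrow>
   (('e \<Rightarrow> 'f \<Rightarrow> complex) \<Rightarrow> complex) nspace" where
  "proj_tensor E F =
     \<lparr>carr = {u. \<exists>x y. tensor_rep E F u x y},
      nrm = (\<lambda>u. Inf {\<Sum>n. nrm E (x n) * nrm F (y n) | x y. tensor_rep E F u x y})\<rparr>"

text \<open>The bounded linear map on the projective tensor product determined by
  \<open>x \<otimes> y \<mapsto> \<beta> x y\<close>, for a bounded bilinear map \<open>\<beta>\<close> into a Banach space \<open>G\<close>.\<close>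

definition tensor_lift ::
  "('e::complex_vector, 'x) nspace_scheme \<Rightarrow> ('f::complex_vector, 'y) nspace_scheme \<Rightarrow>
   ('g::complex_vector, 'z) nspace_scheme \<Rightarrow> ('e \<Rightarrow> 'f \<Rightarrow> 'g) \<Rightarrow>
   (('e \<Rightarrow> 'f \<Rightarrow> complex) \<Rightarrow> complex) \<Rightarrow> 'g" where
  "tensor_lift E F G \<beta> =
     (THE T. T \<in> bounded_ops (proj_tensor E F) G \<and>
             (\<forall>x\<in>carr E. \<forall>y\<in>carr F. T (elem_tensor E F x y) = \<beta> x y))"

type_synonym 'a tensor_square = "('a \<Rightarrow> 'a \<Rightarrow> complex) \<Rightarrow> complex"

definition tensor_bimodule ::
  "('a::complex_vector, 'x) nalgebra_scheme \<Rightarrow> ('a, 'a tensor_square) bimodule" where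
  "tensor_bimodule A =
     \<lparr>carr = carr (proj_tensor A A), nrm = nrm (proj_tensor A A),
      lact = (\<lambda>a. tensor_lift A A (proj_tensor A A) (\<lambda>b c. elem_tensor A A (mult A a b) c)),
      ract = (\<lambda>u a. tensor_lift A A (proj_tensor A A) (\<lambda>b c. elem_tensor A A b (mult A c a)) u)\<rparr>"

definition product_morphism ::
  "('a::complex_vector, 'x) nalgebra_scheme \<Rightarrow> 'a tensor_square \<Rightarrow> 'a" where
  "product_morphism A = tensor_lift A A A (mult A)"


section \<open>Dual Banach algebras and Connes-biprojectivity\<close>

text \<open>Throughout, \<open>P\<close> is the predual \<open>A\<^sub>*\<close>, a set of functionals on \<open>A\<close>.\<close>

definition predual_space ::
  "('a::complex_vector, 'x) nalgebra_scheme \<Rightarrow> ('a \<Rightarrow> complex) set \<Rightarrow> ('a \<Rightarrow> complex) nspace" where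
  "predual_space A P = (dual A)\<lparr>carr := P\<rparr>"

text \<open>The canonical map \<open>A \<rightarrow> (A\<^sub>*)\<^sup>*\<close>.  For a dual Banach algebra it is the identification
  \<open>A = (A\<^sub>*)\<^sup>*\<close>.\<close>

definition canonical_map :: "('a \<Rightarrow> complex) set \<Rightarrow> 'a \<Rightarrow> ('a \<Rightarrow> complex) \<Rightarrow> complex" where
  "canonical_map P a = (\<lambda>\<phi>. if \<phi> \<in> P then \<phi> a else 0)"

definition dual_banach_algebra ::
  "('a::complex_vector, 'x) nalgebra_scheme \<Rightarrow> ('a \<Rightarrow> complex) set \<Rightarrow> bool" where
  "dual_banach_algebra A P \<longleftrightarrow>
     banach_algebra A \<and>
     submodule A (dual_bimodule (algebra_bimodule A)) P \<and>
     closedin (norm_topology (dual A)) P \<and>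
     bij_betw (canonical_map P) (carr A) (carr (dual (predual_space A P))) \<and>
     (\<forall>a\<in>carr A. nrm (dual (predual_space A P)) (canonical_map P a) = nrm A a)"

definition sigma_wc ::
  "('a::complex_vector, 'x) nalgebra_scheme \<Rightarrow> ('a \<Rightarrow> complex) set \<Rightarrow>
   ('a, 'e::complex_vector) bimodule \<Rightarrow> ('a, 'e) bimodule" where
  "sigma_wc A P E = E\<lparr>carr :=
     {x \<in> carr E.
        continuous_map (weak_topology (carr A) P) (weak_topology (carr E) (carr (dual E)))
          (\<lambda>a. lact E a x) \<and>
        continuous_map (weak_topology (carr A) P) (weak_topology (carr E) (carr (dual E)))
          (\<lambda>a. ract E x a)}\<rparr>"

text \<open>The bimodule \<open>(\<sigma>wc((A \<otimes> A)\<^sup>*))\<^sup>*\<close>.\<close>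

definition sigma_wc_bidual ::
  "('a::complex_vector, 'x) nalgebra_scheme \<Rightarrow> ('a \<Rightarrow> complex) set \<Rightarrow>
   ('a, ('a tensor_square \<Rightarrow> complex) \<Rightarrow> complex) bimodule" where
  "sigma_wc_bidual A P = dual_bimodule (sigma_wc A P (dual_bimodule (tensor_bimodule A)))"

text \<open>The adjoint of \<open>\<pi>\<^sup>*|A\<^sub>*\<close>, followed by the identification \<open>(A\<^sub>*)\<^sup>* = A\<close>.\<close>

definition pi_sigma_wc ::
  "('a::complex_vector, 'x) nalgebra_scheme \<Rightarrow> ('a \<Rightarrow> complex) set \<Rightarrow>
   (('a tensor_square \<Rightarrow> complex) \<Rightarrow> complex) \<Rightarrow> 'a" where
  "pi_sigma_wc A P m =
     the_inv_into (carr A) (canonical_map P)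
       (adjoint (predual_space A P) (adjoint (tensor_bimodule A) (product_morphism A)) m)"

definition connes_biprojective ::
  "('a::complex_vector, 'x) nalgebra_scheme \<Rightarrow> ('a \<Rightarrow> complex) set \<Rightarrow> bool" where
  "connes_biprojective A P \<longleftrightarrow>
     (\<exists>\<rho>. bimodule_morphism A (algebra_bimodule A) (sigma_wc_bidual A P) \<rho> \<and>
          bounded_between A (sigma_wc_bidual A P) \<rho> \<and>
          (\<forall>a\<in>carr A. pi_sigma_wc A P (\<rho> a) = a))"

text \<open>Nets of morphisms are rendered as proper filters on the space of maps: a net gives the
  filter generated by its tails, and a proper filter \<open>F\<close> gives the net of all pairs \<open>(\<rho>, X)\<close>
  with \<open>\<rho> \<in> X \<in> F\<close>, ordered by reverse inclusion of \<open>X\<close>, with the same limits.\<close>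

definition approx_connes_biprojective ::
  "('a::complex_vector, 'x) nalgebra_scheme \<Rightarrow> ('a \<Rightarrow> complex) set \<Rightarrow> bool" where
  "approx_connes_biprojective A P \<longleftrightarrow>
     (\<exists>F. F \<noteq> bot \<and>
          (\<forall>\<^sub>F \<rho> in F.
             bimodule_morphism A (algebra_bimodule A) (sigma_wc_bidual A P) \<rho> \<and>
             continuous_map (norm_topology A) (norm_topology (sigma_wc_bidual A P)) \<rho>) \<and>
          (\<forall>a\<in>carr A. ((\<lambda>\<rho>. nrm A (pi_sigma_wc A P (\<rho> a) - a)) \<longlongrightarrow> 0) F))"


section \<open>The algebra \<open>\<ell>\<^sup>2(S)\<close>\<close>

definition l2 :: "'s set \<Rightarrow> ('s \<Rightarrow> complex) nalgebra" where
  "l2 S = \<lparr>carr = {x. (\<lambda>s. (cmod (x s))\<^sup>2) summable_on S \<and> (\<forall>s. s \<notin> S \<longrightarrow> x s = 0)},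
           nrm = (\<lambda>x. sqrt (\<Sum>\<^sub>\<infinity>s\<in>S. (cmod (x s))\<^sup>2)),
           mult = (\<lambda>x y. x * y)\<rparr>"

text \<open>The copy of \<open>\<ell>\<^sup>2(S)\<close> in its dual given by the bilinear (not sesquilinear) pairing.\<close>

definition l2_predual :: "'s set \<Rightarrow> (('s \<Rightarrow> complex) \<Rightarrow> complex) set" where
  "l2_predual S =
     {(\<lambda>x. if x \<in> carr (l2 S) then \<Sum>\<^sub>\<infinity>s\<in>S. x s * y s else 0) | y. y \<in> carr (l2 S)}"

end

(* The algebra A = l2(S) is a Hilbert space, so by Riesz's theorem every bounded functional on A lies
   in the predual.  Hence every orbit map of a Banach A-bimodule is weak*-weakly continuous,
   sigma wc((A (x) A)^* ) is all of (A (x) A)^*, and (sigma wc((A (x) A)^* ))^* is the bidual of A (x) A.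

   Let e_s be the unit vectors.  For finite F the map a |-> sum_{s in F} a(s) e_s (x) e_s is a
   bimodule morphism whose composition with pi is truncation to F, and truncations converge to the
   identity pointwise in norm.

   Conversely e_s is idempotent with e_s u e_s = pi(u)(s) e_s (x) e_s, so a bimodule morphism rho that splits
   pi has to send e_s to e_s (x) e_s.  The functional f on A (x) A induced by the pairing
   (x, y) |-> sum_s x(s) y(s) takes the value 1 on each e_s (x) e_s, so evaluating rho(1_F) at f gives
   |F| <= ||rho|| ||f|| sqrt |F| for all finite F, which is absurd for infinite S. *)
theory Submission
  imports Defs
begin

section \<open>Normed spaces and their duals\<close>

text \<open>A splitting takes values in the bidual, so the compression of tensors is used in
  transposed form: with \<phi> the coordinate functional at s and f in the dual of A \<otimes> A,
  one has e_s . (f . e_s) = f(e_s \<otimes> e_s) (\<phi> o \<pi>). Bimodule linearity gives e_s . m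
  . e_s = m for m = \<rho>(e_s), and the splitting condition gives m(\<phi> o \<pi>) = \<phi>(e_s) =
  1, so m is evaluation at e_s \<otimes> e_s.

  Much of the work comes from the encoding. The module actions on A \<otimes> A and the product
  morphism are definite descriptions, usable only after an explicit operator with the right values
  on elementary tensors has been found and shown to be the only one. Uniqueness rests on the density
  of finite sums of elementary tensors. For the actions the operator is a tensor product of bounded
  maps; for \<pi> it sends u to the function s |-> u(coordinate form at s). The delicate point there
  is square-summability, obtained by testing u against forms built from the coordinates of u
  itself.\<close>

lemma
  assumes "normed_space E"
  shows normed_space_subspace: "complex_vector.subspace (carr E)"
    and normed_space_zero_mem: "0 \<in> carr E"
    and normed_space_add_mem: "x \<in> carr E \<Longrightarrow> y \<in> carr E \<Longrightarrow> x + y \<in> carr E"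
    and normed_space_diff_mem: "x \<in> carr E \<Longrightarrow> y \<in> carr E \<Longrightarrow> x - y \<in> carr E"
    and normed_space_scale_mem: "x \<in> carr E \<Longrightarrow> c *\<^sub>C x \<in> carr E"
    and normed_space_sum_mem: "(\<And>i. i \<in> I \<Longrightarrow> g i \<in> carr E) \<Longrightarrow> sum g I \<in> carr E"
    and nrm_nonneg: "x \<in> carr E \<Longrightarrow> 0 \<le> nrm E x"
    and nrm_eq_0_iff: "x \<in> carr E \<Longrightarrow> nrm E x = 0 \<longleftrightarrow> x = 0"
    and nrm_zero: "nrm E 0 = 0"
    and nrm_scale: "x \<in> carr E \<Longrightarrow> nrm E (c *\<^sub>C x) = cmod c * nrm E x"
    and nrm_triangle: "x \<in> carr E \<Longrightarrow> y \<in> carr E \<Longrightarrow> nrm E (x + y) \<le> nrm E x + nrm E y"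
  using assms
  by (auto simp: normed_space_def complex_vector.subspace_0 complex_vector.subspace_add
      complex_vector.subspace_diff complex_vector.subspace_scale complex_vector.subspace_sum)

lemma
  assumes "linear_between E F T"
  shows linear_between_mem: "x \<in> carr E \<Longrightarrow> T x \<in> carr F"
    and linear_between_add: "x \<in> carr E \<Longrightarrow> y \<in> carr E \<Longrightarrow> T (x + y) = T x + T y"
    and linear_between_scale: "x \<in> carr E \<Longrightarrow> T (c *\<^sub>C x) = c *\<^sub>C T x"
  using assms by (auto simp: linear_between_def)

lemma linear_between_zero:
  assumes "linear_between E F T" "normed_space E"
  shows "T 0 = 0"
  using linear_between_scale[OF assms(1) normed_space_zero_mem[OF assms(2)], of 0] by simp

lemma linear_between_diff:
  assumes "linear_between E F T" "normed_space E" "x \<in> carr E" "y \<in> carr E"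
  shows "T (x - y) = T x - T y"
  using linear_between_add[OF assms(1,3) normed_space_scale_mem[OF assms(2,4), of "-1"]]
    linear_between_scale[OF assms(1,4), of "-1"] by simp

lemma linear_between_sum:
  assumes "linear_between E F T" "normed_space E" "\<And>i. i \<in> I \<Longrightarrow> g i \<in> carr E"
  shows "T (sum g I) = (\<Sum>i\<in>I. T (g i))"
  using assms(3)
proof (induction I rule: infinite_finite_induct)
  case (insert i I)
  then show ?case
    by (simp add: linear_between_add[OF assms(1)] normed_space_sum_mem[OF assms(2)])
qed (simp_all add: linear_between_zero[OF assms(1,2)])

text \<open>\<open>bounded_between\<close> puts no sign on its constant; passing to the absolute
  value gives one that can be used in monotonicity arguments.\<close>

lemma bounded_betweenE:
  assumes "bounded_between E F T" "normed_space E"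
  obtains K where "K \<ge> 0" "\<And>x. x \<in> carr E \<Longrightarrow> nrm F (T x) \<le> K * nrm E x"
proof -
  obtain K where K: "\<And>x. x \<in> carr E \<Longrightarrow> nrm F (T x) \<le> K * nrm E x"
    using assms(1) by (auto simp: bounded_between_def)
  have "nrm F (T x) \<le> \<bar>K\<bar> * nrm E x" if "x \<in> carr E" for x
    using K[OF that] mult_right_mono[OF abs_ge_self[of K] nrm_nonneg[OF assms(2) that]] by linarith
  then show thesis using that[of "\<bar>K\<bar>"] by simp
qed

lemma bounded_linear_continuous_map:
  assumes "normed_space E" "normed_space F" "linear_between E F T" "bounded_between E F T"
  shows "continuous_map (norm_topology E) (norm_topology F) T"
proof -
  interpret E: Metric_space "carr E" "norm_dist E" by (rule Metric_space_norm_dist[OF assms(1)])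
  interpret F: Metric_space "carr F" "norm_dist F" by (rule Metric_space_norm_dist[OF assms(2)])
  obtain K where K: "K \<ge> 0" "\<And>x. x \<in> carr E \<Longrightarrow> nrm F (T x) \<le> K * nrm E x"
    using bounded_betweenE[OF assms(4,1)] by blast
  have "\<exists>\<delta>>0. \<forall>x. x \<in> carr E \<and> norm_dist E a x < \<delta> \<longrightarrow> norm_dist F (T a) (T x) < \<epsilon>"
    if a: "a \<in> carr E" and "\<epsilon> > 0" for a \<epsilon>
  proof (intro exI conjI allI impI)
    \<comment> \<open>The summand 1 keeps the quotient meaningful when K = 0.\<close>
    show "\<epsilon> / (K + 1) > 0" using K(1) \<open>\<epsilon> > 0\<close> by simp
    fix x assume x: "x \<in> carr E \<and> norm_dist E a x < \<epsilon> / (K + 1)"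
    then have d: "nrm E (a - x) < \<epsilon> / (K + 1)" using a by (auto simp: norm_dist_def)
    have n0: "nrm E (a - x) \<ge> 0" using nrm_nonneg[OF assms(1)] normed_space_diff_mem[OF assms(1)] a x by blast
    have "norm_dist F (T a) (T x) = nrm F (T (a - x))"
      using a x linear_between_mem[OF assms(3)]
      by (simp add: norm_dist_def linear_between_diff[OF assms(3,1)])
    also have "\<dots> \<le> K * nrm E (a - x)" using K(2) a x normed_space_diff_mem[OF assms(1)] by blast
    also have "\<dots> \<le> (K + 1) * nrm E (a - x)" using n0 by (simp add: mult_right_mono)
    also have "\<dots> < \<epsilon>" using d K(1) by (simp add: field_simps)
    finally show "norm_dist F (T a) (T x) < \<epsilon>" .
  qed
  then show ?thesis
    unfolding norm_topology_def E.metric_continuous_map[OF F.Metric_space_axioms]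
    using linear_between_mem[OF assms(3)] by blast
qed

section \<open>Dual spaces and the dual norm\<close>

lemma bounded_ops_iff:
  "T \<in> bounded_ops E F \<longleftrightarrow>
     linear_between E F T \<and> bounded_between E F T \<and> (\<forall>x. x \<notin> carr E \<longrightarrow> T x = 0)"
  by (simp add: bounded_ops_def)

lemma carr_dual_iff:
  "f \<in> carr (dual E) \<longleftrightarrow>
     linear_between E complex_space f \<and> bounded_between E complex_space f \<and>
     (\<forall>x. x \<notin> carr E \<longrightarrow> f x = 0)"
  by (simp add: dual_def bounded_ops_iff)

lemma linear_between_complex_iff:
  "linear_between E complex_space f \<longleftrightarrow>
     (\<forall>x\<in>carr E. \<forall>y\<in>carr E. f (x + y) = f x + f y) \<and> (\<forall>c. \<forall>x\<in>carr E. f (c *\<^sub>C x) = c * f x)"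
  by (simp add: linear_between_def scaleC_complex_def)

lemma bounded_between_complex_iff:
  "bounded_between E complex_space f \<longleftrightarrow> (\<exists>K. \<forall>x\<in>carr E. cmod (f x) \<le> K * nrm E x)"
  by (simp add: bounded_between_def)

text \<open>A real \<open>Sup\<close> is informative only for sets bounded above; any constant from
  \<open>bounded_between\<close> bounds the values on the unit ball.\<close>

lemma bdd_above_unit_ball_image:
  assumes E: "normed_space E" and f: "f \<in> carr (dual E)"
  shows "bdd_above {cmod (f x) | x. x \<in> carr E \<and> nrm E x \<le> 1}"
proof -
  have bd: "bounded_between E complex_space f" using f by (simp add: carr_dual_iff)
  obtain K where K: "K \<ge> 0" "\<And>x. x \<in> carr E \<Longrightarrow> nrm complex_space (f x) \<le> K * nrm E x"
    using bounded_betweenE[OF bd E] by blast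
  show "bdd_above {cmod (f x) | x. x \<in> carr E \<and> nrm E x \<le> 1}"
  proof (rule bdd_aboveI[of _ K], safe)
    fix z assume z: "z \<in> carr E" "nrm E z \<le> 1"
    then show "cmod (f z) \<le> K" using K(2)[OF z(1)] mult_left_mono[OF z(2) K(1)] by simp
  qed
qed

lemma dual_norm_bound:
  assumes E: "normed_space E" and f: "f \<in> carr (dual E)" and x: "x \<in> carr E"
  shows "cmod (f x) \<le> nrm (dual E) f * nrm E x"
proof (cases "x = 0")
  case True
  then show ?thesis
    using f linear_between_zero[OF _ E, of complex_space f] by (simp add: carr_dual_iff nrm_zero[OF E])
next
  case False
  have lin: "linear_between E complex_space f" using f by (simp add: carr_dual_iff)
  have pos: "nrm E x > 0" using nrm_nonneg[OF E x] nrm_eq_0_iff[OF E x] False by simp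
  \<comment> \<open>Scaling x to norm 1 places \<open>f y\<close> in the set whose supremum is the
    dual norm.\<close>
  define y where "y = complex_of_real (1 / nrm E x) *\<^sub>C x"
  have y: "y \<in> carr E" using x normed_space_scale_mem[OF E] by (simp add: y_def)
  have "nrm E y = 1"
    using nrm_scale[OF E x, of "complex_of_real (1 / nrm E x)"] pos by (simp add: y_def norm_divide)
  have "bdd_above {cmod (f x) | x. x \<in> carr E \<and> nrm E x \<le> 1}"
    by (rule bdd_above_unit_ball_image[OF E f])
  then have "cmod (f y) \<le> nrm (dual E) f"
    using y \<open>nrm E y = 1\<close> by (auto simp: dual_def intro!: cSup_upper)
  moreover have "f y = f x / complex_of_real (nrm E x)"
    using linear_between_scale[OF lin x] by (simp add: y_def scaleC_complex_def)
  ultimately show ?thesis using pos by (simp add: norm_divide field_simps)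
qed

lemma dual_norm_le:
  assumes E: "normed_space E" and "K \<ge> 0" and le: "\<And>x. x \<in> carr E \<Longrightarrow> cmod (f x) \<le> K * nrm E x"
  shows "nrm (dual E) f \<le> K"
  unfolding dual_def nspace.simps
proof (rule cSup_least)
  show "{cmod (f x) |x. x \<in> carr E \<and> nrm E x \<le> 1} \<noteq> {}"
    using normed_space_zero_mem[OF E] nrm_zero[OF E] by force
  fix r assume "r \<in> {cmod (f x) |x. x \<in> carr E \<and> nrm E x \<le> 1}"
  then obtain x where x: "r = cmod (f x)" "x \<in> carr E" "nrm E x \<le> 1" by blast
  then show "r \<le> K" using le[OF x(2)] mult_left_mono[OF x(3) \<open>K \<ge> 0\<close>] by simp
qed

lemma dual_norm_nonneg:
  assumes E: "normed_space E" and f: "f \<in> carr (dual E)"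
  shows "0 \<le> nrm (dual E) f"
proof -
  have "bdd_above {cmod (f x) | x. x \<in> carr E \<and> nrm E x \<le> 1}"
    by (rule bdd_above_unit_ball_image[OF E f])
  then have "cmod (f 0) \<le> nrm (dual E) f"
    using normed_space_zero_mem[OF E] nrm_zero[OF E] by (auto simp: dual_def intro!: cSup_upper)
  then show ?thesis by (rule order_trans[OF norm_ge_zero])
qed

lemma dual_memI:
  assumes "\<And>x y. x \<in> carr E \<Longrightarrow> y \<in> carr E \<Longrightarrow> f (x + y) = f x + f y"
    and "\<And>c x. x \<in> carr E \<Longrightarrow> f (c *\<^sub>C x) = c * f x"
    and "\<And>x. x \<in> carr E \<Longrightarrow> cmod (f x) \<le> K * nrm E x"
    and "\<And>x. x \<notin> carr E \<Longrightarrow> f x = 0"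
  shows "f \<in> carr (dual E)"
  unfolding carr_dual_iff linear_between_complex_iff bounded_between_complex_iff
  using assms by blast

lemma
  assumes "f \<in> carr (dual E)"
  shows dual_add: "x \<in> carr E \<Longrightarrow> y \<in> carr E \<Longrightarrow> f (x + y) = f x + f y"
    and dual_scale: "x \<in> carr E \<Longrightarrow> f (c *\<^sub>C x) = c * f x"
    and dual_outside: "x \<notin> carr E \<Longrightarrow> f x = 0"
  using assms by (auto simp: carr_dual_iff linear_between_complex_iff)

text \<open>Each norm inequality is a pointwise estimate fed to \<open>dual_norm_le\<close>.
  Definiteness relies on members of the dual being 0 off the carrier: the norm alone controls a
  functional only on the carrier.\<close>

lemma normed_space_dual:
  assumes E: "normed_space E"
  shows "normed_space (dual E)"
proof -
  have add: "f + g \<in> carr (dual E) \<and> nrm (dual E) (f + g) \<le> nrm (dual E) f + nrm (dual E) g"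
    if f: "f \<in> carr (dual E)" and g: "g \<in> carr (dual E)" for f g
  proof -
    have le: "cmod ((f + g) x) \<le> (nrm (dual E) f + nrm (dual E) g) * nrm E x" if "x \<in> carr E" for x
      using dual_norm_bound[OF E f that] dual_norm_bound[OF E g that]
        norm_triangle_ineq[of "f x" "g x"] by (simp add: algebra_simps)
    show ?thesis
    proof
      show "f + g \<in> carr (dual E)"
        by (rule dual_memI[OF _ _ le])
          (simp_all add: dual_add[OF f] dual_add[OF g] dual_scale[OF f] dual_scale[OF g]
            dual_outside[OF f] dual_outside[OF g] algebra_simps)
      show "nrm (dual E) (f + g) \<le> nrm (dual E) f + nrm (dual E) g"
        by (rule dual_norm_le[OF E _ le]) (simp add: dual_norm_nonneg[OF E] f g)
    qed
  qed
  have scale: "c *\<^sub>C f \<in> carr (dual E) \<and> nrm (dual E) (c *\<^sub>C f) \<le> cmod c * nrm (dual E) f"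
    if f: "f \<in> carr (dual E)" for f c
  proof -
    have le: "cmod ((c *\<^sub>C f) x) \<le> (cmod c * nrm (dual E) f) * nrm E x" if "x \<in> carr E" for x
      using mult_left_mono[OF dual_norm_bound[OF E f that], of "cmod c"]
      by (simp add: scaleC_fun_def scaleC_complex_def norm_mult algebra_simps)
    show ?thesis
    proof
      show "c *\<^sub>C f \<in> carr (dual E)"
        by (rule dual_memI[OF _ _ le])
          (simp_all add: dual_add[OF f] dual_scale[OF f] dual_outside[OF f] algebra_simps
            scaleC_fun_def scaleC_complex_def)
      show "nrm (dual E) (c *\<^sub>C f) \<le> cmod c * nrm (dual E) f"
        by (rule dual_norm_le[OF E _ le]) (simp add: dual_norm_nonneg[OF E] f)
    qed
  qed
  have zero: "0 \<in> carr (dual E)" "nrm (dual E) 0 = 0"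
  proof -
    show z: "0 \<in> carr (dual E)" by (rule dual_memI[where K = 0]) simp_all
    show "nrm (dual E) 0 = 0"
      using dual_norm_le[OF E, of 0 0] dual_norm_nonneg[OF E z] by simp
  qed
  have eq0: "f = 0" if f: "f \<in> carr (dual E)" and "nrm (dual E) f = 0" for f
  proof
    show "f x = 0 x" for x
      using dual_norm_bound[OF E f] dual_outside[OF f] that(2) by (cases "x \<in> carr E") force+
  qed
  have hom: "nrm (dual E) (c *\<^sub>C f) = cmod c * nrm (dual E) f" if f: "f \<in> carr (dual E)" for f c
  proof (cases "c = 0")
    case False
    \<comment> \<open>Scaling back by \<open>inverse c\<close> turns the inequality
      \<open>scale\<close> into its reverse.\<close>
    have "nrm (dual E) f \<le> cmod (inverse c) * nrm (dual E) (c *\<^sub>C f)"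
      using scale[of "c *\<^sub>C f" "inverse c"] scale[OF f, of c] False by (simp add: scaleC_scaleC scaleC_one)
    then have "cmod c * nrm (dual E) f \<le> nrm (dual E) (c *\<^sub>C f)"
      using False by (simp add: norm_inverse norm_divide field_simps)
    then show ?thesis using scale[OF f, of c] by simp
  qed (simp add: zero)
  show ?thesis
    unfolding normed_space_def complex_vector.subspace_def
    using add scale zero eq0 hom dual_norm_nonneg[OF E] by blast
qed

section \<open>Adjoint operators\<close>

lemma
  assumes E: "normed_space E" and F: "normed_space F" and T: "linear_between E F T" and K: "K \<ge> 0"
    and le: "\<And>x. x \<in> carr E \<Longrightarrow> nrm F (T x) \<le> K * nrm E x" and f: "f \<in> carr (dual F)"
  shows adjoint_mem: "adjoint E T f \<in> carr (dual E)"
    and adjoint_norm_le: "nrm (dual E) (adjoint E T f) \<le> K * nrm (dual F) f"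
proof -
  have le': "cmod (adjoint E T f x) \<le> (K * nrm (dual F) f) * nrm E x" if x: "x \<in> carr E" for x
  proof -
    have "cmod (f (T x)) \<le> nrm (dual F) f * nrm F (T x)"
      by (rule dual_norm_bound[OF F f linear_between_mem[OF T x]])
    also have "\<dots> \<le> nrm (dual F) f * (K * nrm E x)"
      by (rule mult_left_mono[OF le[OF x] dual_norm_nonneg[OF F f]])
    finally show ?thesis using x by (simp add: adjoint_def algebra_simps)
  qed
  show "adjoint E T f \<in> carr (dual E)"
    by (rule dual_memI[OF _ _ le'])
      (simp_all add: adjoint_def normed_space_add_mem[OF E] normed_space_scale_mem[OF E] linear_between_mem[OF T]
        linear_between_add[OF T] linear_between_scale[OF T] dual_add[OF f] dual_scale[OF f])
  show "nrm (dual E) (adjoint E T f) \<le> K * nrm (dual F) f"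
    by (rule dual_norm_le[OF E _ le']) (simp_all add: K dual_norm_nonneg[OF F f])
qed

lemma linear_between_adjoint:
  assumes "normed_space E" "normed_space F" "linear_between E F T" "bounded_between E F T"
  shows "linear_between (dual F) (dual E) (adjoint E T)"
    and "bounded_between (dual F) (dual E) (adjoint E T)"
proof -
  obtain K where K: "K \<ge> 0" "\<And>x. x \<in> carr E \<Longrightarrow> nrm F (T x) \<le> K * nrm E x"
    using bounded_betweenE[OF assms(4,1)] by blast
  show "linear_between (dual F) (dual E) (adjoint E T)"
    using adjoint_mem[OF assms(1-3) K]
    by (auto simp: linear_between_def adjoint_def scaleC_fun_def)
  show "bounded_between (dual F) (dual E) (adjoint E T)"
    using adjoint_norm_le[OF assms(1-3) K] by (auto simp: bounded_between_def)
qed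

section \<open>The projective tensor product\<close>

lemma bilinear_formsI:
  assumes "\<And>x y y'. x \<in> carr E \<Longrightarrow> y \<in> carr F \<Longrightarrow> y' \<in> carr F \<Longrightarrow> B x (y + y') = B x y + B x y'"
    and "\<And>x y c. x \<in> carr E \<Longrightarrow> y \<in> carr F \<Longrightarrow> B x (c *\<^sub>C y) = c * B x y"
    and "\<And>x x' y. x \<in> carr E \<Longrightarrow> x' \<in> carr E \<Longrightarrow> y \<in> carr F \<Longrightarrow> B (x + x') y = B x y + B x' y"
    and "\<And>x y c. x \<in> carr E \<Longrightarrow> y \<in> carr F \<Longrightarrow> B (c *\<^sub>C x) y = c * B x y"
    and "\<And>x y. x \<in> carr E \<Longrightarrow> y \<in> carr F \<Longrightarrow> cmod (B x y) \<le> K * nrm E x * nrm F y"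
  shows "B \<in> bilinear_forms E F"
  unfolding bilinear_forms_def linear_between_complex_iff using assms by blast

lemma
  assumes "B \<in> bilinear_forms E F"
  shows bilinear_forms_add_right:
      "x \<in> carr E \<Longrightarrow> y \<in> carr F \<Longrightarrow> y' \<in> carr F \<Longrightarrow> B x (y + y') = B x y + B x y'"
    and bilinear_forms_scale_right: "x \<in> carr E \<Longrightarrow> y \<in> carr F \<Longrightarrow> B x (c *\<^sub>C y) = c * B x y"
    and bilinear_forms_add_left:
      "x \<in> carr E \<Longrightarrow> x' \<in> carr E \<Longrightarrow> y \<in> carr F \<Longrightarrow> B (x + x') y = B x y + B x' y"
    and bilinear_forms_scale_left: "x \<in> carr E \<Longrightarrow> y \<in> carr F \<Longrightarrow> B (c *\<^sub>C x) y = c * B x y"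
  using assms unfolding bilinear_forms_def linear_between_complex_iff by blast+

lemma bilinear_forms_bound:
  assumes "B \<in> bilinear_forms E F" "normed_space E" "normed_space F"
  shows "\<exists>K\<ge>0. \<forall>x\<in>carr E. \<forall>y\<in>carr F. cmod (B x y) \<le> K * (nrm E x * nrm F y)"
proof -
  obtain K where K: "\<And>x y. x \<in> carr E \<Longrightarrow> y \<in> carr F \<Longrightarrow> cmod (B x y) \<le> K * nrm E x * nrm F y"
    using assms(1) unfolding bilinear_forms_def by blast
  have "cmod (B x y) \<le> \<bar>K\<bar> * (nrm E x * nrm F y)" if "x \<in> carr E" "y \<in> carr F" for x y
  proof -
    have "K * (nrm E x * nrm F y) \<le> \<bar>K\<bar> * (nrm E x * nrm F y)"
      using nrm_nonneg[OF assms(2) that(1)] nrm_nonneg[OF assms(3) that(2)]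
      by (intro mult_right_mono) auto
    then show ?thesis using K[OF that] by (simp add: mult.assoc)
  qed
  then show ?thesis by (intro exI[of _ "\<bar>K\<bar>"]) simp
qed

text \<open>Forms, unlike members of \<open>bounded_ops\<close>, are not set to 0 off the carriers,
  so different functions may agree as forms. Every condition in \<open>bilinear_forms\<close> speaks
  of values on the carriers only.\<close>

lemma bilinear_forms_cong:
  assumes "\<And>x y. x \<in> carr E \<Longrightarrow> y \<in> carr F \<Longrightarrow> B x y = B' x y"
    and "normed_space E" "normed_space F"
  shows "B \<in> bilinear_forms E F \<longleftrightarrow> B' \<in> bilinear_forms E F"
  unfolding bilinear_forms_def linear_between_complex_iff
  using assms(1) normed_space_add_mem[OF assms(2)] normed_space_add_mem[OF assms(3)]
    normed_space_scale_mem[OF assms(2)] normed_space_scale_mem[OF assms(3)]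
  by simp

lemma bilinear_forms_add:
  assumes "B \<in> bilinear_forms E F" "B' \<in> bilinear_forms E F" "normed_space E" "normed_space F"
  shows "(\<lambda>x y. B x y + B' x y) \<in> bilinear_forms E F"
proof -
  obtain K where K: "K \<ge> 0"
    "\<And>x y. x \<in> carr E \<Longrightarrow> y \<in> carr F \<Longrightarrow> cmod (B x y) \<le> K * (nrm E x * nrm F y)"
    using bilinear_forms_bound[OF assms(1,3,4)] by blast
  obtain L where L: "L \<ge> 0"
    "\<And>x y. x \<in> carr E \<Longrightarrow> y \<in> carr F \<Longrightarrow> cmod (B' x y) \<le> L * (nrm E x * nrm F y)"
    using bilinear_forms_bound[OF assms(2,3,4)] by blast
  show ?thesis
  proof (rule bilinear_formsI[where K = "K + L"])
    fix x y assume "x \<in> carr E" "y \<in> carr F"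
    then show "cmod (B x y + B' x y) \<le> (K + L) * nrm E x * nrm F y"
      using norm_triangle_ineq[of "B x y" "B' x y"] K(2)[of x y] L(2)[of x y] by (simp add: algebra_simps)
  qed (simp_all add: algebra_simps
      bilinear_forms_add_right[OF assms(1)] bilinear_forms_add_right[OF assms(2)]
      bilinear_forms_scale_right[OF assms(1)] bilinear_forms_scale_right[OF assms(2)]
      bilinear_forms_add_left[OF assms(1)] bilinear_forms_add_left[OF assms(2)]
      bilinear_forms_scale_left[OF assms(1)] bilinear_forms_scale_left[OF assms(2)])
qed

lemma bilinear_forms_scale:
  assumes "B \<in> bilinear_forms E F" "normed_space E" "normed_space F"
  shows "(\<lambda>x y. c * B x y) \<in> bilinear_forms E F"
proof -
  obtain K where K: "K \<ge> 0"
    "\<And>x y. x \<in> carr E \<Longrightarrow> y \<in> carr F \<Longrightarrow> cmod (B x y) \<le> K * (nrm E x * nrm F y)"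
    using bilinear_forms_bound[OF assms] by blast
  show ?thesis
  proof (rule bilinear_formsI[where K = "cmod c * K"])
    fix x y assume "x \<in> carr E" "y \<in> carr F"
    then show "cmod (c * B x y) \<le> cmod c * K * nrm E x * nrm F y"
      using mult_left_mono[OF K(2)[of x y], of "cmod c"] by (simp add: algebra_simps norm_mult)
  qed (simp_all add: algebra_simps
      bilinear_forms_add_right[OF assms(1)] bilinear_forms_scale_right[OF assms(1)]
      bilinear_forms_add_left[OF assms(1)] bilinear_forms_scale_left[OF assms(1)])
qed

lemma bilinear_forms_compose:
  assumes B: "B \<in> bilinear_forms E' F'"
    and "normed_space E" "normed_space F" "normed_space E'" "normed_space F'"
    and S: "linear_between E E' S" "bounded_between E E' S"
    and R: "linear_between F F' R" "bounded_between F F' R"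
  shows "(\<lambda>x y. B (S x) (R y)) \<in> bilinear_forms E F"
proof -
  obtain K where K: "K \<ge> 0" "\<And>x y. x \<in> carr E' \<Longrightarrow> y \<in> carr F' \<Longrightarrow> cmod (B x y) \<le> K * (nrm E' x * nrm F' y)"
    using bilinear_forms_bound[OF B assms(4,5)] by blast
  obtain M where M: "M \<ge> 0" "\<And>x. x \<in> carr E \<Longrightarrow> nrm E' (S x) \<le> M * nrm E x"
    using bounded_betweenE[OF S(2) assms(2)] by blast
  obtain N where N: "N \<ge> 0" "\<And>x. x \<in> carr F \<Longrightarrow> nrm F' (R x) \<le> N * nrm F x"
    using bounded_betweenE[OF R(2) assms(3)] by blast
  note mem = linear_between_mem[OF S(1)] linear_between_mem[OF R(1)]
  show ?thesis
  proof (rule bilinear_formsI[where K = "K * (M * N)"])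
    fix x y assume xy: "x \<in> carr E" "y \<in> carr F"
    have "cmod (B (S x) (R y)) \<le> K * (nrm E' (S x) * nrm F' (R y))"
      using K(2) mem xy by blast
    also have "\<dots> \<le> K * ((M * nrm E x) * (N * nrm F y))"
      using M N xy K(1) nrm_nonneg[OF assms(5) mem(2)[OF xy(2)]] nrm_nonneg[OF assms(2) xy(1)]
      by (intro mult_left_mono mult_mono) simp_all
    finally show "cmod (B (S x) (R y)) \<le> K * (M * N) * nrm E x * nrm F y"
      by (simp add: algebra_simps)
  qed (simp_all add: mem linear_between_add[OF S(1)] linear_between_add[OF R(1)]
      linear_between_scale[OF S(1)] linear_between_scale[OF R(1)]
      bilinear_forms_add_right[OF B] bilinear_forms_scale_right[OF B]
      bilinear_forms_add_left[OF B] bilinear_forms_scale_left[OF B])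
qed

section \<open>Series representations and the projective norm\<close>

lemma bilinear_series_sums:
  assumes "B \<in> bilinear_forms E F" "normed_space E" "normed_space F"
    and "range x \<subseteq> carr E" "range y \<subseteq> carr F" "summable (\<lambda>n. nrm E (x n) * nrm F (y n))"
  shows "(\<lambda>n. B (x n) (y n)) sums (\<Sum>n. B (x n) (y n))"
proof -
  obtain K where K: "K \<ge> 0"
    "\<And>x y. x \<in> carr E \<Longrightarrow> y \<in> carr F \<Longrightarrow> cmod (B x y) \<le> K * (nrm E x * nrm F y)"
    using bilinear_forms_bound[OF assms(1-3)] by blast
  have "summable (\<lambda>n. K * (nrm E (x n) * nrm F (y n)))" using assms(6) by (rule summable_mult)
  then have "summable (\<lambda>n. B (x n) (y n))"
  proof (rule summable_comparison_test'[where N = 0])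
    show "norm (B (x n) (y n)) \<le> K * (nrm E (x n) * nrm F (y n))" for n
      using assms(4,5) by (intro K(2)) auto
  qed
  then show ?thesis by (rule summable_sums)
qed

text \<open>\<open>suminf\<close> by itself carries no convergence information. Summability of the
  norm products makes the series converge for every bounded form, which turns the defining equation
  into statements that can be added, scaled and shifted.\<close>

lemma tensor_rep_iff:
  assumes "normed_space E" "normed_space F"
  shows "tensor_rep E F u x y \<longleftrightarrow>
    range x \<subseteq> carr E \<and> range y \<subseteq> carr F \<and> summable (\<lambda>n. nrm E (x n) * nrm F (y n)) \<and>
    (\<forall>B\<in>bilinear_forms E F. (\<lambda>n. B (x n) (y n)) sums u B) \<and> (\<forall>B. B \<notin> bilinear_forms E F \<longrightarrow> u B = 0)"
    (is "?l \<longleftrightarrow> ?r")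
proof
  assume l: ?l
  have u: "u = (\<lambda>B. \<Sum>n. elem_tensor E F (x n) (y n) B)" using l by (simp add: tensor_rep_def)
  show ?r
    using l bilinear_series_sums[OF _ assms, of _ x y]
    by (simp add: tensor_rep_def[of E F u x y]) (simp add: u elem_tensor_def)
next
  assume r: ?r
  have "u B = (\<Sum>n. elem_tensor E F (x n) (y n) B)" for B
    using r by (cases "B \<in> bilinear_forms E F") (auto simp: elem_tensor_def sums_iff)
  then show ?l using r by (auto simp: tensor_rep_def)
qed

lemma carr_proj_tensor_iff: "u \<in> carr (proj_tensor E F) \<longleftrightarrow> (\<exists>x y. tensor_rep E F u x y)"
  by (simp add: proj_tensor_def)

lemma tensor_rep_mem:
  assumes "tensor_rep E F u x y"
  shows "x n \<in> carr E" "y n \<in> carr F"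
  using assms by (auto simp: tensor_rep_def)

lemma tensor_rep_norm_nonneg:
  assumes "normed_space E" "normed_space F" "tensor_rep E F u x y"
  shows "0 \<le> nrm E (x n) * nrm F (y n)"
  using assms by (auto simp: tensor_rep_def intro!: mult_nonneg_nonneg nrm_nonneg)

lemma proj_norm_le:
  assumes "normed_space E" "normed_space F" "tensor_rep E F u x y"
  shows "nrm (proj_tensor E F) u \<le> (\<Sum>n. nrm E (x n) * nrm F (y n))"
  unfolding proj_tensor_def nspace.simps
proof (rule cInf_lower)
  show "bdd_below {\<Sum>n. nrm E (x n) * nrm F (y n) |x y. tensor_rep E F u x y}"
    by (rule bdd_belowI[of _ 0])
      (auto simp: tensor_rep_def intro!: suminf_nonneg tensor_rep_norm_nonneg[OF assms(1,2)])
qed (use assms(3) in blast)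

text \<open>After division by K this is the infimum property. For K = 0 division is impossible, but
  any single representation already gives \<open>c \<le> 0\<close>.\<close>

lemma proj_norm_greatest:
  assumes "u \<in> carr (proj_tensor E F)" "K \<ge> 0"
    and "\<And>x y. tensor_rep E F u x y \<Longrightarrow> c \<le> K * (\<Sum>n. nrm E (x n) * nrm F (y n))"
  shows "c \<le> K * nrm (proj_tensor E F) u"
proof (cases "K = 0")
  case True
  then show ?thesis using assms(1,3) by (auto simp: carr_proj_tensor_iff)
next
  case False
  then have K: "K > 0" using assms(2) by simp
  have "c / K \<le> nrm (proj_tensor E F) u"
    unfolding proj_tensor_def nspace.simps
  proof (rule cInf_greatest)
    show "{\<Sum>n. nrm E (x n) * nrm F (y n) |x y. tensor_rep E F u x y} \<noteq> {}"
      using assms(1) by (auto simp: carr_proj_tensor_iff)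
  qed (use assms(3) K in \<open>auto simp: field_simps\<close>)
  then show ?thesis using K by (simp add: field_simps)
qed

lemma proj_norm_approx:
  assumes "u \<in> carr (proj_tensor E F)" "\<epsilon> > 0"
  obtains x y where "tensor_rep E F u x y"
    "(\<Sum>n. nrm E (x n) * nrm F (y n)) < nrm (proj_tensor E F) u + \<epsilon>"
proof (rule ccontr)
  assume "\<not> thesis"
  then have "nrm (proj_tensor E F) u + \<epsilon> \<le> 1 * nrm (proj_tensor E F) u"
    using assms(1) that by (intro proj_norm_greatest) force+
  then show False using assms(2) by simp
qed

text \<open>The estimate holds term by term along every representation and passes to the infimum. It
  is the source of lower bounds for the projective norm and makes each bounded form a bounded
  functional on tensors.\<close>

lemma tensor_form_bound:
  assumes "normed_space E" "normed_space F" "u \<in> carr (proj_tensor E F)"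
    and B: "B \<in> bilinear_forms E F" and "K \<ge> 0"
    and le: "\<And>x y. x \<in> carr E \<Longrightarrow> y \<in> carr F \<Longrightarrow> cmod (B x y) \<le> K * (nrm E x * nrm F y)"
  shows "cmod (u B) \<le> K * nrm (proj_tensor E F) u"
proof (rule proj_norm_greatest[OF assms(3,5)])
  fix x y assume r: "tensor_rep E F u x y"
  then have s: "(\<lambda>n. B (x n) (y n)) sums u B" and mem: "range x \<subseteq> carr E" "range y \<subseteq> carr F"
    and sm: "summable (\<lambda>n. nrm E (x n) * nrm F (y n))"
    using B by (auto simp: tensor_rep_iff[OF assms(1,2)])
  have "cmod (\<Sum>n. B (x n) (y n)) \<le> (\<Sum>n. K * (nrm E (x n) * nrm F (y n)))"
    by (rule norm_suminf_le) (use mem sm in \<open>auto intro!: summable_mult le\<close>)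
  then show "cmod (u B) \<le> K * (\<Sum>n. nrm E (x n) * nrm F (y n))"
    using s sm by (simp add: sums_iff suminf_mult)
qed

text \<open>Along a representation of u both forms produce the same terms; outside
  \<open>bilinear_forms\<close> both values are 0. This permits rewriting a form by laws that hold
  only on the carriers.\<close>

lemma tensor_form_cong:
  assumes "normed_space E" "normed_space F" "u \<in> carr (proj_tensor E F)"
    and eq: "\<And>x y. x \<in> carr E \<Longrightarrow> y \<in> carr F \<Longrightarrow> B x y = B' x y"
  shows "u B = u B'"
proof -
  obtain x y where r: "tensor_rep E F u x y" using assms(3) by (auto simp: carr_proj_tensor_iff)
  have "B (x n) (y n) = B' (x n) (y n)" for n using tensor_rep_mem[OF r] by (intro eq)
  moreover have "B \<in> bilinear_forms E F \<longleftrightarrow> B' \<in> bilinear_forms E F"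
    by (rule bilinear_forms_cong) (use assms in auto)
  ultimately show ?thesis
    using r sums_unique2[of "\<lambda>n. B (x n) (y n)" "u B" "u B'"]
    by (cases "B \<in> bilinear_forms E F") (auto simp: tensor_rep_iff[OF assms(1,2)])
qed

text \<open>By encoding a tensor is merely a function on forms. Its additivity is inherited from the
  terms of a representation, which are evaluations.\<close>

lemma tensor_form_add:
  assumes "normed_space E" "normed_space F" "u \<in> carr (proj_tensor E F)"
    and "B \<in> bilinear_forms E F" "B' \<in> bilinear_forms E F"
  shows "u (\<lambda>x y. B x y + B' x y) = u B + u B'"
proof -
  obtain x y where r: "tensor_rep E F u x y" using assms(3) by (auto simp: carr_proj_tensor_iff)
  then have "(\<lambda>n. B (x n) (y n) + B' (x n) (y n)) sums (u B + u B')"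
    using assms(4,5) by (intro sums_add) (auto simp: tensor_rep_iff[OF assms(1,2)])
  moreover have "(\<lambda>n. B (x n) (y n) + B' (x n) (y n)) sums u (\<lambda>x y. B x y + B' x y)"
    using r bilinear_forms_add[OF assms(4,5,1,2)] by (auto simp: tensor_rep_iff[OF assms(1,2)])
  ultimately show ?thesis using sums_unique2 by blast
qed

lemma tensor_form_scale:
  assumes "normed_space E" "normed_space F" "u \<in> carr (proj_tensor E F)"
    and "B \<in> bilinear_forms E F"
  shows "u (\<lambda>x y. c * B x y) = c * u B"
proof -
  obtain x y where r: "tensor_rep E F u x y" using assms(3) by (auto simp: carr_proj_tensor_iff)
  then have "(\<lambda>n. c * B (x n) (y n)) sums (c * u B)"
    using assms(4) by (intro sums_mult) (auto simp: tensor_rep_iff[OF assms(1,2)])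
  moreover have "(\<lambda>n. c * B (x n) (y n)) sums u (\<lambda>x y. c * B x y)"
    using r bilinear_forms_scale[OF assms(4,1,2)] by (auto simp: tensor_rep_iff[OF assms(1,2)])
  ultimately show ?thesis using sums_unique2 by blast
qed

text \<open>A sum of two tensors has to be represented by a single sequence; placing the two series
  at even and odd positions achieves this.\<close>

lemma sums_interleave:
  fixes f g :: "nat \<Rightarrow> 'a::real_normed_vector"
  assumes "f sums a" "g sums b"
  shows "(\<lambda>n. if even n then f (n div 2) else g (n div 2)) sums (a + b)"
proof -
  have "(\<lambda>n. if even n then f (n div 2) else 0) sums a"
  proof (subst sums_mono_reindex[symmetric, where g = "\<lambda>n. 2 * n"])
    show "strict_mono (\<lambda>n::nat. 2 * n)" by (simp add: strict_mono_def)
  qed (use assms(1) in \<open>auto elim!: evenE\<close>)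
  moreover have "(\<lambda>n. if odd n then g (n div 2) else 0) sums b"
  proof (subst sums_mono_reindex[symmetric, where g = "\<lambda>n. 2 * n + 1"])
    show "strict_mono (\<lambda>n::nat. 2 * n + 1)" by (simp add: strict_mono_def)
  qed (use assms(2) in \<open>auto elim!: oddE\<close>)
  ultimately have "(\<lambda>n. (if even n then f (n div 2) else 0) + (if odd n then g (n div 2) else 0)) sums (a + b)"
    by (rule sums_add)
  moreover have "(\<lambda>n. (if even n then f (n div 2) else 0) + (if odd n then g (n div 2) else 0)) =
      (\<lambda>n. if even n then f (n div 2) else g (n div 2))"
    by auto
  ultimately show ?thesis by simp
qed

lemma scaleC_apply: "(c *\<^sub>C f) x = c * f x" for f :: "'a \<Rightarrow> complex"
  by (simp add: scaleC_fun_def scaleC_complex_def)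

text \<open>The one-term series is padded with zeros, and the padding contributes nothing because
  \<open>B 0 0 = 0\<close> for every form.\<close>

lemma tensor_rep_elem:
  assumes "normed_space E" "normed_space F" "x \<in> carr E" "y \<in> carr F"
  shows "tensor_rep E F (elem_tensor E F x y) (\<lambda>n. if n = 0 then x else 0) (\<lambda>n. if n = 0 then y else 0)"
    and "(\<Sum>n. nrm E (if n = (0::nat) then x else 0) * nrm F (if n = 0 then y else 0)) = nrm E x * nrm F y"
proof -
  have s: "(\<lambda>n. nrm E (if n = (0::nat) then x else 0) * nrm F (if n = 0 then y else 0)) sums (nrm E x * nrm F y)"
  proof -
    have "(\<lambda>n. nrm E (if n = (0::nat) then x else 0) * nrm F (if n = 0 then y else 0)) =
        (\<lambda>n. if n = 0 then nrm E x * nrm F y else 0)"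
      by (auto simp: nrm_zero[OF assms(1)])
    then show ?thesis using sums_single[of 0 "\<lambda>_. nrm E x * nrm F y"] by simp
  qed
  have "(\<lambda>n. B (if n = (0::nat) then x else 0) (if n = 0 then y else 0)) sums B x y"
    if B: "B \<in> bilinear_forms E F" for B
  proof -
    have "B 0 0 = 0"
      using bilinear_forms_scale_left[OF B normed_space_zero_mem[OF assms(1)] normed_space_zero_mem[OF assms(2)], of 0]
      by simp
    then have "(\<lambda>n. B (if n = (0::nat) then x else 0) (if n = 0 then y else 0)) = (\<lambda>n. if n = 0 then B x y else 0)"
      by auto
    then show ?thesis using sums_single[of 0 "\<lambda>_. B x y"] by simp
  qed
  then show "tensor_rep E F (elem_tensor E F x y) (\<lambda>n. if n = 0 then x else 0) (\<lambda>n. if n = 0 then y else 0)"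
    using s assms normed_space_zero_mem[OF assms(1)] normed_space_zero_mem[OF assms(2)]
    by (auto simp: tensor_rep_iff[OF assms(1,2)] elem_tensor_def sums_iff)
  show "(\<Sum>n. nrm E (if n = (0::nat) then x else 0) * nrm F (if n = 0 then y else 0)) = nrm E x * nrm F y"
    using s by (simp add: sums_iff)
qed

lemma
  assumes "normed_space E" "normed_space F" "x \<in> carr E" "y \<in> carr F"
  shows elem_tensor_mem: "elem_tensor E F x y \<in> carr (proj_tensor E F)"
    and elem_tensor_norm_le: "nrm (proj_tensor E F) (elem_tensor E F x y) \<le> nrm E x * nrm F y"
  using tensor_rep_elem(1)[OF assms] proj_norm_le[OF assms(1,2) tensor_rep_elem(1)[OF assms]]
    tensor_rep_elem(2)[OF assms]
  unfolding carr_proj_tensor_iff by (blast, simp)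

lemma elem_tensor_scale_left:
  assumes "x \<in> carr E" "y \<in> carr F"
  shows "elem_tensor E F (c *\<^sub>C x) y = c *\<^sub>C elem_tensor E F x y"
  using assms by (auto simp: fun_eq_iff elem_tensor_def scaleC_fun_def scaleC_complex_def
      bilinear_forms_scale_left)

lemma elem_tensor_scale_right:
  assumes "x \<in> carr E" "y \<in> carr F"
  shows "elem_tensor E F x (c *\<^sub>C y) = c *\<^sub>C elem_tensor E F x y"
  using assms by (auto simp: fun_eq_iff elem_tensor_def scaleC_fun_def scaleC_complex_def
      bilinear_forms_scale_right)

lemma tensor_rep_add:
  assumes "normed_space E" "normed_space F" "tensor_rep E F u x y" "tensor_rep E F v x' y'"
  defines "X \<equiv> \<lambda>n. if even n then x (n div 2) else x' (n div 2)"
    and "Y \<equiv> \<lambda>n. if even n then y (n div 2) else y' (n div 2)"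
  shows "tensor_rep E F (u + v) X Y"
    and "(\<Sum>n. nrm E (X n) * nrm F (Y n)) =
      (\<Sum>n. nrm E (x n) * nrm F (y n)) + (\<Sum>n. nrm E (x' n) * nrm F (y' n))"
proof -
  have X: "nrm E (X n) * nrm F (Y n) =
      (if even n then nrm E (x (n div 2)) * nrm F (y (n div 2)) else nrm E (x' (n div 2)) * nrm F (y' (n div 2)))" for n
    by (simp add: X_def Y_def)
  have Y: "B (X n) (Y n) = (if even n then B (x (n div 2)) (y (n div 2)) else B (x' (n div 2)) (y' (n div 2)))"
    for B :: "_ \<Rightarrow> _ \<Rightarrow> complex" and n
    by (simp add: X_def Y_def)
  have s: "(\<lambda>n. nrm E (X n) * nrm F (Y n)) sums
      ((\<Sum>n. nrm E (x n) * nrm F (y n)) + (\<Sum>n. nrm E (x' n) * nrm F (y' n)))"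
    unfolding X
    using assms(3,4) by (intro sums_interleave summable_sums) (auto simp: tensor_rep_def)
  then show "(\<Sum>n. nrm E (X n) * nrm F (Y n)) =
      (\<Sum>n. nrm E (x n) * nrm F (y n)) + (\<Sum>n. nrm E (x' n) * nrm F (y' n))"
    by (simp add: sums_iff)
  have "(\<lambda>n. B (X n) (Y n)) sums (u + v) B" if "B \<in> bilinear_forms E F" for B
    unfolding Y[of B] plus_fun_apply
    using assms(3,4) that by (intro sums_interleave) (auto simp: tensor_rep_iff[OF assms(1,2)])
  then show "tensor_rep E F (u + v) X Y"
    using assms(3,4) s unfolding tensor_rep_iff[OF assms(1,2)]
    by (auto simp: X_def Y_def sums_iff)
qed

lemma tensor_rep_scale:
  assumes "normed_space E" "normed_space F" "tensor_rep E F u x y"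
  shows "tensor_rep E F (c *\<^sub>C u) (\<lambda>n. c *\<^sub>C x n) y"
proof -
  have mem: "x n \<in> carr E" "y n \<in> carr F" for n using assms(3) by (auto simp: tensor_rep_def)
  have "(\<lambda>n. B (c *\<^sub>C x n) (y n)) sums (c *\<^sub>C u) B" if B: "B \<in> bilinear_forms E F" for B
    using assms(3) B mem sums_mult[of "\<lambda>n. B (x n) (y n)" "u B" c]
    by (simp add: tensor_rep_iff[OF assms(1,2)] bilinear_forms_scale_left[OF B]
        scaleC_fun_def scaleC_complex_def)
  moreover have "summable (\<lambda>n. nrm E (c *\<^sub>C x n) * nrm F (y n))"
    using assms(3) mem summable_mult[of "\<lambda>n. nrm E (x n) * nrm F (y n)" "cmod c"]
    by (simp add: tensor_rep_def nrm_scale[OF assms(1)] mult.assoc)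
  ultimately show ?thesis
    using assms(3) mem normed_space_scale_mem[OF assms(1)] unfolding tensor_rep_iff[OF assms(1,2)]
    by (auto simp: scaleC_fun_def scaleC_complex_def)
qed

lemma normed_space_proj_tensor:
  assumes E: "normed_space E" and F: "normed_space F"
  shows "normed_space (proj_tensor E F)"
proof -
  let ?P = "proj_tensor E F"
  have zero: "0 \<in> carr ?P" "nrm ?P 0 \<le> 0"
  proof -
    have mem: "0 \<in> carr E" "0 \<in> carr F"
      using normed_space_zero_mem[OF E] normed_space_zero_mem[OF F] .
    have "elem_tensor E F 0 0 = 0"
      using elem_tensor_scale_left[OF mem, of 0] by simp
    then show "0 \<in> carr ?P" "nrm ?P 0 \<le> 0"
      using elem_tensor_mem[OF E F mem] elem_tensor_norm_le[OF E F mem] nrm_zero[OF E] by simp_all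
  qed
  have nonneg: "0 \<le> nrm ?P u" if "u \<in> carr ?P" for u
    using proj_norm_greatest[OF that, of 1 0] tensor_rep_norm_nonneg[OF E F]
    by (simp add: suminf_nonneg tensor_rep_def)
  have add: "u + v \<in> carr ?P \<and> nrm ?P (u + v) \<le> nrm ?P u + nrm ?P v"
    if u: "u \<in> carr ?P" and v: "v \<in> carr ?P" for u v
  proof
    show "u + v \<in> carr ?P"
      using u v tensor_rep_add(1)[OF E F] unfolding carr_proj_tensor_iff by blast
    show "nrm ?P (u + v) \<le> nrm ?P u + nrm ?P v"
    proof (rule field_le_epsilon)
      fix e :: real assume "e > 0"
      \<comment> \<open>Half of the error goes to each of two nearly optimal representations, which
        are then interleaved.\<close>
      then have e: "e / 2 > 0" by simp
      obtain x y where 1: "tensor_rep E F u x y" "(\<Sum>n. nrm E (x n) * nrm F (y n)) < nrm ?P u + e / 2"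
        using proj_norm_approx[OF u e] .
      obtain x' y' where 2: "tensor_rep E F v x' y'" "(\<Sum>n. nrm E (x' n) * nrm F (y' n)) < nrm ?P v + e / 2"
        using proj_norm_approx[OF v e] .
      show "nrm ?P (u + v) \<le> nrm ?P u + nrm ?P v + e"
        using proj_norm_le[OF E F tensor_rep_add(1)[OF E F 1(1) 2(1)]]
          tensor_rep_add(2)[OF E F 1(1) 2(1)] 1(2) 2(2) by simp
    qed
  qed
  have scale: "c *\<^sub>C u \<in> carr ?P \<and> nrm ?P (c *\<^sub>C u) \<le> cmod c * nrm ?P u"
    if u: "u \<in> carr ?P" for u c
  proof
    show "c *\<^sub>C u \<in> carr ?P"
      using u tensor_rep_scale[OF E F] unfolding carr_proj_tensor_iff by blast
    show "nrm ?P (c *\<^sub>C u) \<le> cmod c * nrm ?P u"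
    proof (rule proj_norm_greatest[OF u])
      fix x y assume r: "tensor_rep E F u x y"
      then have "(\<Sum>n. nrm E (c *\<^sub>C x n) * nrm F (y n)) = cmod c * (\<Sum>n. nrm E (x n) * nrm F (y n))"
        by (subst suminf_mult[symmetric]) (auto simp: tensor_rep_def nrm_scale[OF E] mult.assoc image_subset_iff)
      then show "nrm ?P (c *\<^sub>C u) \<le> cmod c * (\<Sum>n. nrm E (x n) * nrm F (y n))"
        using proj_norm_le[OF E F tensor_rep_scale[OF E F r, of c]] by simp
    qed simp
  qed
  have hom: "nrm ?P (c *\<^sub>C u) = cmod c * nrm ?P u" if u: "u \<in> carr ?P" for u c
  proof (cases "c = 0")
    case True
    then show ?thesis using zero nonneg[OF zero(1)] by simp
  next
    case False
    have "nrm ?P u \<le> cmod (inverse c) * nrm ?P (c *\<^sub>C u)"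
      using scale[of "c *\<^sub>C u" "inverse c"] scale[OF u, of c] False by (simp add: scaleC_scaleC scaleC_one)
    then have "cmod c * nrm ?P u \<le> nrm ?P (c *\<^sub>C u)"
      using False by (simp add: norm_inverse norm_divide field_simps)
    then show ?thesis using scale[OF u, of c] by simp
  qed
  \<comment> \<open>Forms separate tensors: a tensor of norm 0 vanishes at every bounded form by
    \<open>tensor_form_bound\<close>, and elsewhere it is 0 by encoding.\<close>
  have eq0: "u = 0" if u: "u \<in> carr ?P" and "nrm ?P u = 0" for u
  proof
    fix B
    show "u B = 0 B"
    proof (cases "B \<in> bilinear_forms E F")
      case True
      obtain K where "K \<ge> 0" "\<And>x y. x \<in> carr E \<Longrightarrow> y \<in> carr F \<Longrightarrow> cmod (B x y) \<le> K * (nrm E x * nrm F y)"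
        using bilinear_forms_bound[OF True E F] by blast
      from tensor_form_bound[OF E F u True this] that(2) show ?thesis by simp
    next
      case False
      then show ?thesis using u by (auto simp: carr_proj_tensor_iff tensor_rep_iff[OF E F])
    qed
  qed
  show ?thesis
    unfolding normed_space_def complex_vector.subspace_def
    using add scale zero eq0 hom nonneg nonneg[OF zero(1)] by fastforce
qed

section \<open>Uniqueness of bounded operators with given values on elementary tensors\<close>

lemma tensor_rep_tail:
  assumes "normed_space E" "normed_space F" "tensor_rep E F u x y"
  shows "tensor_rep E F (u - (\<Sum>i<n. elem_tensor E F (x i) (y i))) (\<lambda>i. x (i + n)) (\<lambda>i. y (i + n))"
proof -
  have ap: "(\<Sum>i<n. elem_tensor E F (x i) (y i)) B =
      (if B \<in> bilinear_forms E F then \<Sum>i<n. B (x i) (y i) else 0)" for B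
    by (induction n) (simp_all add: elem_tensor_def)
  have "summable (\<lambda>i. nrm E (x (i + n)) * nrm F (y (i + n)))"
    using assms(3) by (intro summable_ignore_initial_segment[of "\<lambda>i. nrm E (x i) * nrm F (y i)"])
      (simp add: tensor_rep_def)
  then show ?thesis
    using assms(3) unfolding tensor_rep_iff[OF assms(1,2)]
    by (auto simp: ap intro: sums_split_initial_segment[of "\<lambda>i. B (x i) (y i)" for B])
qed

text \<open>Both operators agree on finite sums of elementary tensors. Cutting a representation of u
  after n terms leaves a remainder whose projective norm is at most the tail of a convergent series,
  so boundedness forces agreement at u.\<close>

lemma bounded_ops_proj_tensor_eqI:
  assumes E: "normed_space E" and F: "normed_space F" and G: "normed_space G"
    and T: "T \<in> bounded_ops (proj_tensor E F) G" and T': "T' \<in> bounded_ops (proj_tensor E F) G"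
    and eq: "\<And>x y. x \<in> carr E \<Longrightarrow> y \<in> carr F \<Longrightarrow> T (elem_tensor E F x y) = T' (elem_tensor E F x y)"
  shows "T = T'"
proof
  fix u
  let ?P = "proj_tensor E F"
  note P = normed_space_proj_tensor[OF E F]
  show "T u = T' u"
  proof (cases "u \<in> carr ?P")
    case True
    then obtain x y where r: "tensor_rep E F u x y" by (auto simp: carr_proj_tensor_iff)
    have lin: "linear_between ?P G T" "linear_between ?P G T'"
      and bd: "bounded_between ?P G T" "bounded_between ?P G T'"
      using T T' by (auto simp: bounded_ops_iff)
    obtain K where K: "K \<ge> 0" "\<And>v. v \<in> carr ?P \<Longrightarrow> nrm G (T v) \<le> K * nrm ?P v"
      using bounded_betweenE[OF bd(1) P] by blast
    obtain L where L: "L \<ge> 0" "\<And>v. v \<in> carr ?P \<Longrightarrow> nrm G (T' v) \<le> L * nrm ?P v"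
      using bounded_betweenE[OF bd(2) P] by blast
    define a where "a n = nrm E (x n) * nrm F (y n)" for n
    have sa: "summable a" using r by (simp add: tensor_rep_def a_def[abs_def])
    \<comment> \<open>The left side is independent of n, while the right side is a multiple of the
      n-th tail.\<close>
    have le: "nrm G (T u - T' u) \<le> (K + L) * (suminf a - (\<Sum>i<n. a i))" for n
    proof -
      define p where "p = (\<Sum>i<n. elem_tensor E F (x i) (y i))"
      have el: "elem_tensor E F (x i) (y i) \<in> carr ?P" for i
        using r by (intro elem_tensor_mem[OF E F]) (auto simp: tensor_rep_def)
      have p: "p \<in> carr ?P" unfolding p_def using el by (rule normed_space_sum_mem[OF P])
      define v where "v = u - p"
      have v: "v \<in> carr ?P" unfolding v_def by (rule normed_space_diff_mem[OF P True p])
      have "T p = T' p"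
        unfolding p_def
        by (simp add: el eq tensor_rep_mem[OF r] linear_between_sum[OF lin(1) P] linear_between_sum[OF lin(2) P])
      then have "T u - T' u = T v - T' v"
        using linear_between_diff[OF lin(1) P True p] linear_between_diff[OF lin(2) P True p]
        by (simp add: v_def)
      also have "nrm G \<dots> \<le> nrm G (T v) + nrm G (T' v)"
        using nrm_triangle[OF G linear_between_mem[OF lin(1) v] normed_space_scale_mem[OF G linear_between_mem[OF lin(2) v]], of "-1"]
          nrm_scale[OF G linear_between_mem[OF lin(2) v], of "-1"] by simp
      also have "\<dots> \<le> (K + L) * nrm ?P v"
        using K(2)[OF v] L(2)[OF v] by (simp add: algebra_simps)
      also have "\<dots> \<le> (K + L) * (\<Sum>i. a (i + n))"
        using proj_norm_le[OF E F tensor_rep_tail[OF E F r, of n]] K(1) L(1)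
        by (intro mult_left_mono) (simp_all add: v_def p_def a_def)
      also have "(\<Sum>i. a (i + n)) = suminf a - (\<Sum>i<n. a i)"
        by (rule suminf_minus_initial_segment[OF sa])
      finally show ?thesis .
    qed
    have "(\<lambda>n. (K + L) * (suminf a - (\<Sum>i<n. a i))) \<longlonglongrightarrow> (K + L) * (suminf a - suminf a)"
      by (intro tendsto_intros summable_LIMSEQ sa)
    then have "nrm G (T u - T' u) \<le> (K + L) * (suminf a - suminf a)"
      by (rule LIMSEQ_le_const) (use le in blast)
    moreover have d: "T u - T' u \<in> carr G"
      using normed_space_diff_mem[OF G] linear_between_mem[OF lin(1)] linear_between_mem[OF lin(2)] True by blast
    ultimately show ?thesis
      using nrm_nonneg[OF G d] nrm_eq_0_iff[OF G d] by simp
  qed (use T T' in \<open>simp add: bounded_ops_iff\<close>)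
qed

text \<open>This resolves the definite description in \<open>tensor_lift\<close>: existence is
  supplied by the candidate T, uniqueness by density.\<close>

lemma tensor_lift_eqI:
  assumes "normed_space E" "normed_space F" "normed_space G"
    and "T \<in> bounded_ops (proj_tensor E F) G"
    and "\<And>x y. x \<in> carr E \<Longrightarrow> y \<in> carr F \<Longrightarrow> T (elem_tensor E F x y) = \<beta> x y"
  shows "tensor_lift E F G \<beta> = T"
  unfolding tensor_lift_def
proof (rule the_equality)
  fix T' assume "T' \<in> bounded_ops (proj_tensor E F) G \<and> (\<forall>x\<in>carr E. \<forall>y\<in>carr F. T' (elem_tensor E F x y) = \<beta> x y)"
  then show "T' = T" using assms by (intro bounded_ops_proj_tensor_eqI[OF assms(1-3)]) auto
qed (use assms in auto)

section \<open>Functionals and operators induced on tensor products\<close>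

definition tensor_functional ::
  "('e::complex_vector, 'x) nspace_scheme \<Rightarrow> ('f::complex_vector, 'y) nspace_scheme \<Rightarrow>
   ('e \<Rightarrow> 'f \<Rightarrow> complex) \<Rightarrow> (('e \<Rightarrow> 'f \<Rightarrow> complex) \<Rightarrow> complex) \<Rightarrow> complex" where
  "tensor_functional E F B = (\<lambda>u. if u \<in> carr (proj_tensor E F) then u B else 0)"

text \<open>Linearity in u is pointwise, as tensors are functions on forms; the norm estimate is
  \<open>tensor_form_bound\<close>.\<close>

lemma tensor_functional_mem:
  assumes E: "normed_space E" and F: "normed_space F" and B: "B \<in> bilinear_forms E F"
  shows "tensor_functional E F B \<in> carr (dual (proj_tensor E F))"
proof -
  obtain K where K: "K \<ge> 0" "\<And>x y. x \<in> carr E \<Longrightarrow> y \<in> carr F \<Longrightarrow> cmod (B x y) \<le> K * (nrm E x * nrm F y)"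
    using bilinear_forms_bound[OF B E F] by blast
  note P = normed_space_proj_tensor[OF E F]
  show ?thesis
    by (rule dual_memI[where K = K])
      (simp_all add: tensor_functional_def normed_space_add_mem[OF P] normed_space_scale_mem[OF P]
        tensor_form_bound[OF E F _ B K] scaleC_apply)
qed

text \<open>The operator S \<otimes> R, written as the transpose of the substitution of S and R into
  a form. The guards give the value 0 off the carrier, as \<open>bounded_ops\<close> demands, and
  the value 0 at arguments that are not forms, as every tensor has.\<close>

definition tensor_map ::
  "('e::complex_vector, 'x) nspace_scheme \<Rightarrow> ('f::complex_vector, 'y) nspace_scheme \<Rightarrow>
   ('g::complex_vector, 'z) nspace_scheme \<Rightarrow> ('h::complex_vector, 'w) nspace_scheme \<Rightarrow>
   ('e \<Rightarrow> 'g) \<Rightarrow> ('f \<Rightarrow> 'h) \<Rightarrow> (('e \<Rightarrow> 'f \<Rightarrow> complex) \<Rightarrow> complex) \<Rightarrow> ('g \<Rightarrow> 'h \<Rightarrow> complex) \<Rightarrow> complex"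
  where
  "tensor_map E F G H S R u = (\<lambda>B. if u \<in> carr (proj_tensor E F) \<and> B \<in> bilinear_forms G H
     then u (\<lambda>x y. B (S x) (R y)) else 0)"

context
  fixes E :: "('e::complex_vector, 'x) nspace_scheme" and F :: "('f::complex_vector, 'y) nspace_scheme"
    and G :: "('g::complex_vector, 'z) nspace_scheme" and H :: "('h::complex_vector, 'w) nspace_scheme"
    and S :: "'e \<Rightarrow> 'g" and R :: "'f \<Rightarrow> 'h" and K L :: real
  assumes E: "normed_space E" and F: "normed_space F" and G: "normed_space G" and H: "normed_space H"
    and S: "linear_between E G S" and R: "linear_between F H R"
    and K: "K \<ge> 0" "\<And>x. x \<in> carr E \<Longrightarrow> nrm G (S x) \<le> K * nrm E x"
    and L: "L \<ge> 0" "\<And>y. y \<in> carr F \<Longrightarrow> nrm H (R y) \<le> L * nrm F y"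
begin

lemma tensor_map_form:
  assumes "B \<in> bilinear_forms G H"
  shows "(\<lambda>x y. B (S x) (R y)) \<in> bilinear_forms E F"
  by (rule bilinear_forms_compose[OF assms E F G H S _ R]) (use K L in \<open>auto simp: bounded_between_def\<close>)

text \<open>Applying S and R termwise carries a representation of u to one of the image, at the cost
  of a factor \<open>K * L\<close> in the sum of norms. Membership in the tensor product and the
  operator bound both follow from this.\<close>

lemma tensor_map_rep:
  assumes "tensor_rep E F u x y"
  shows "tensor_rep G H (tensor_map E F G H S R u) (\<lambda>n. S (x n)) (\<lambda>n. R (y n))"
    and "(\<Sum>n. nrm G (S (x n)) * nrm H (R (y n))) \<le> K * L * (\<Sum>n. nrm E (x n) * nrm F (y n))"
proof -
  have mem: "x n \<in> carr E" "y n \<in> carr F" "S (x n) \<in> carr G" "R (y n) \<in> carr H" for n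
    using tensor_rep_mem[OF assms] linear_between_mem[OF S] linear_between_mem[OF R] by blast+
  have le: "nrm G (S (x n)) * nrm H (R (y n)) \<le> K * L * (nrm E (x n) * nrm F (y n))" for n
    using mult_mono[OF K(2)[OF mem(1)] L(2)[OF mem(2)], of n n] K(1)
      nrm_nonneg[OF E mem(1)] nrm_nonneg[OF H mem(4)] by (simp add: algebra_simps)
  have s: "summable (\<lambda>n. K * L * (nrm E (x n) * nrm F (y n)))"
    using assms by (intro summable_mult) (simp add: tensor_rep_def)
  have s': "summable (\<lambda>n. nrm G (S (x n)) * nrm H (R (y n)))"
    by (rule summable_comparison_test'[OF s, where N = 0])
      (use le nrm_nonneg[OF G mem(3)] nrm_nonneg[OF H mem(4)] in simp)
  show "(\<Sum>n. nrm G (S (x n)) * nrm H (R (y n))) \<le> K * L * (\<Sum>n. nrm E (x n) * nrm F (y n))"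
    using suminf_le[OF le s' s] assms by (simp add: suminf_mult tensor_rep_def)
  have u: "u \<in> carr (proj_tensor E F)" using assms by (auto simp: carr_proj_tensor_iff)
  show "tensor_rep G H (tensor_map E F G H S R u) (\<lambda>n. S (x n)) (\<lambda>n. R (y n))"
    unfolding tensor_rep_iff[OF G H]
  proof (intro conjI ballI allI impI)
    fix B assume B: "B \<in> bilinear_forms G H"
    then show "(\<lambda>n. B (S (x n)) (R (y n))) sums tensor_map E F G H S R u B"
      using assms tensor_map_form[OF B] u by (auto simp: tensor_map_def tensor_rep_iff[OF E F])
  qed (use mem s' in \<open>auto simp: tensor_map_def\<close>)
qed

lemma tensor_map_mem:
  assumes "u \<in> carr (proj_tensor E F)"
  shows "tensor_map E F G H S R u \<in> carr (proj_tensor G H)"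
  using assms tensor_map_rep(1) unfolding carr_proj_tensor_iff by blast

lemma tensor_map_norm_le:
  assumes "u \<in> carr (proj_tensor E F)"
  shows "nrm (proj_tensor G H) (tensor_map E F G H S R u) \<le> K * L * nrm (proj_tensor E F) u"
proof (rule proj_norm_greatest[OF assms])
  fix x y assume r: "tensor_rep E F u x y"
  show "nrm (proj_tensor G H) (tensor_map E F G H S R u) \<le> K * L * (\<Sum>n. nrm E (x n) * nrm F (y n))"
    using proj_norm_le[OF G H tensor_map_rep(1)[OF r]] tensor_map_rep(2)[OF r] by linarith
qed (use K L in simp)

lemma tensor_map_bounded_ops: "tensor_map E F G H S R \<in> bounded_ops (proj_tensor E F) (proj_tensor G H)"
proof -
  note P = normed_space_proj_tensor[OF E F]
  show ?thesis
    unfolding bounded_ops_iff linear_between_def bounded_between_def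
    using tensor_map_mem tensor_map_norm_le
    by (auto simp: fun_eq_iff tensor_map_def normed_space_add_mem[OF P] normed_space_scale_mem[OF P]
        scaleC_apply)
qed

lemma tensor_map_elem:
  assumes "x \<in> carr E" "y \<in> carr F"
  shows "tensor_map E F G H S R (elem_tensor E F x y) = elem_tensor G H (S x) (R y)"
  using assms tensor_map_form elem_tensor_mem[OF E F assms]
  by (auto simp: fun_eq_iff tensor_map_def elem_tensor_def)

end

section \<open>Normed bimodules\<close>

text \<open>E and E' may be records of different types, such as a normed space and a bimodule over
  it; the dual depends only on the two common fields.\<close>

lemma dual_cong: "carr E = carr E' \<Longrightarrow> nrm E = nrm E' \<Longrightarrow> dual E = dual E'"
  by (simp add: dual_def bounded_ops_def linear_between_def bounded_between_def)

lemma normed_space_cong: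
  "carr E = carr E' \<Longrightarrow> nrm E = nrm E' \<Longrightarrow> normed_space E \<longleftrightarrow> normed_space E'"
  by (simp add: normed_space_def)

text \<open>Collects what makes orbit maps bounded: actions linear in each variable and contractive.
  Completeness and the associativity laws of a module are not part of it.\<close>

definition normed_bimodule ::
  "('a::complex_vector, 'x) nalgebra_scheme \<Rightarrow> ('a, 'e::complex_vector, 'y) bimodule_scheme \<Rightarrow> bool"
  where
  "normed_bimodule A E \<longleftrightarrow>
     normed_space E \<and>
     (\<forall>a\<in>carr A. linear_between E E (lact E a) \<and> linear_between E E (\<lambda>x. ract E x a)) \<and>
     (\<forall>x\<in>carr E. linear_between A E (\<lambda>a. lact E a x) \<and> linear_between A E (ract E x)) \<and>
     (\<forall>a\<in>carr A. \<forall>x\<in>carr E.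
        nrm E (lact E a x) \<le> nrm A a * nrm E x \<and> nrm E (ract E x a) \<le> nrm A a * nrm E x)"

text \<open>The left action of a on the dual is the adjoint of the right action on E, and
  conversely, so the norm bounds are those of adjoints. Linearity in a comes from the orbit maps of
  E.\<close>

lemma normed_bimodule_dual:
  fixes E :: "('a::complex_vector, 'e::complex_vector, 'y) bimodule_scheme"
  assumes A: "normed_space A" and M: "normed_bimodule A E"
  shows "normed_bimodule A (dual_bimodule E)"
proof -
  let ?D = "dual_bimodule E"
  have E: "normed_space E" using M by (simp add: normed_bimodule_def)
  have cD: "carr ?D = carr (dual E)" and nD: "nrm ?D = nrm (dual E)"
    by (simp_all add: dual_bimodule_def)
  have D: "normed_space ?D" using normed_space_dual[OF E] normed_space_cong[OF cD nD] by simp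
  have lE: "linear_between E E (lact E a)" "linear_between E E (\<lambda>x. ract E x a)" if "a \<in> carr A" for a
    using M that by (auto simp: normed_bimodule_def)
  have lA: "linear_between A E (\<lambda>a. lact E a x)" "linear_between A E (ract E x)" if "x \<in> carr E" for x
    using M that by (auto simp: normed_bimodule_def)
  have nE: "nrm E (lact E a x) \<le> nrm A a * nrm E x" "nrm E (ract E x a) \<le> nrm A a * nrm E x"
    if "a \<in> carr A" "x \<in> carr E" for a x
    using M that by (auto simp: normed_bimodule_def)
  have l: "lact ?D a f \<in> carr (dual E) \<and> nrm (dual E) (lact ?D a f) \<le> nrm A a * nrm (dual E) f"
    and r: "ract ?D f a \<in> carr (dual E) \<and> nrm (dual E) (ract ?D f a) \<le> nrm A a * nrm (dual E) f"
    if "a \<in> carr A" "f \<in> carr (dual E)" for a f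
    using adjoint_mem[OF E E lE(1)[OF that(1)] nrm_nonneg[OF A that(1)] nE(1)[OF that(1)] that(2)]
      adjoint_norm_le[OF E E lE(1)[OF that(1)] nrm_nonneg[OF A that(1)] nE(1)[OF that(1)] that(2)]
      adjoint_mem[OF E E lE(2)[OF that(1)] nrm_nonneg[OF A that(1)] nE(2)[OF that(1)] that(2)]
      adjoint_norm_le[OF E E lE(2)[OF that(1)] nrm_nonneg[OF A that(1)] nE(2)[OF that(1)] that(2)]
    by (simp_all add: dual_bimodule_def adjoint_def)
  show ?thesis
    unfolding normed_bimodule_def linear_between_def
    using D l r
    by (auto simp: dual_bimodule_def fun_eq_iff scaleC_apply dual_add dual_scale
        linear_between_mem[OF lA(1)] linear_between_mem[OF lA(2)]
        linear_between_add[OF lA(1)] linear_between_add[OF lA(2)]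
        linear_between_scale[OF lA(1)] linear_between_scale[OF lA(2)])
qed

lemma normed_bimodule_algebra:
  assumes "banach_algebra A"
  shows "normed_bimodule A (algebra_bimodule A)"
proof -
  have "nrm A (mult A x a) \<le> nrm A a * nrm A x" if "a \<in> carr A" "x \<in> carr A" for a x
    using assms that by (simp add: banach_algebra_def mult.commute[of "nrm A a"])
  then show ?thesis
    using assms normed_space_cong[of "algebra_bimodule A" A]
    by (auto simp: normed_bimodule_def algebra_bimodule_def banach_algebra_def banach_space_def
        linear_between_def)
qed

lemma submodule_whole:
  assumes "normed_bimodule A E"
  shows "submodule A E (carr E)"
  using assms normed_space_subspace[of E]
  by (auto simp: submodule_def normed_bimodule_def dest: linear_between_mem)

section \<open>Weak topologies and the case where the predual is the whole dual\<close>

lemma continuous_map_weak_topology_functional: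
  assumes "\<phi> \<in> P"
  shows "continuous_map (weak_topology X P) euclidean \<phi>"
proof -
  have "continuous_map (weak_topology X P) euclidean ((\<lambda>g. g \<phi>) \<circ> (\<lambda>x. \<lambda>f\<in>P. f x))"
    unfolding weak_topology_def
    by (rule continuous_map_pullback[OF continuous_map_product_projection[OF assms]])
  then show ?thesis using assms by (simp add: o_def)
qed

lemma topspace_weak_topology: "topspace (weak_topology X P) = X"
  by (auto simp: weak_topology_def topspace_pullback_topology)

lemma continuous_map_into_weak_topology:
  assumes "g \<in> topspace T \<rightarrow> X" "\<And>f. f \<in> P \<Longrightarrow> continuous_map T euclidean (\<lambda>a. f (g a))"
  shows "continuous_map T (weak_topology X P) g"
  unfolding weak_topology_def
proof (rule continuous_map_pullback')
  show "continuous_map T (product_topology (\<lambda>_. euclidean) P) ((\<lambda>x. \<lambda>f\<in>P. f x) \<circ> g)"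
    using assms(2) by (auto simp: continuous_map_componentwise)
qed (use assms(1) in auto)

text \<open>The orbit maps of x are bounded with constant the norm of x. Composed with a bounded
  functional on E they are bounded functionals on A, hence members of P and continuous by the very
  definition of the topology.\<close>

lemma sigma_wc_reflexive:
  assumes A: "normed_space A" and M: "normed_bimodule A E" and P: "P = carr (dual A)"
  shows "sigma_wc A P E = E"
proof -
  have E: "normed_space E" using M by (simp add: normed_bimodule_def)
  have cont: "continuous_map (weak_topology (carr A) P) (weak_topology (carr E) (carr (dual E))) T"
    if T: "linear_between A E T" and K: "K \<ge> 0" "\<And>a. a \<in> carr A \<Longrightarrow> nrm E (T a) \<le> nrm A a * K" for T K
  proof (rule continuous_map_into_weak_topology)
    show "T \<in> topspace (weak_topology (carr A) P) \<rightarrow> carr E"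
      using linear_between_mem[OF T] by (auto simp: topspace_weak_topology)
    fix f assume f: "f \<in> carr (dual E)"
    \<comment> \<open>The composite is set to 0 off the carrier in order to be a member of
      \<open>dual A\<close>; the topology on \<open>carr A\<close> does not notice the
      change.\<close>
    define \<phi> where "\<phi> a = (if a \<in> carr A then f (T a) else 0)" for a
    have "\<phi> \<in> carr (dual A)"
    proof (rule dual_memI[where K = "nrm (dual E) f * K"])
      fix a assume a: "a \<in> carr A"
      have "cmod (f (T a)) \<le> nrm (dual E) f * nrm E (T a)"
        by (rule dual_norm_bound[OF E f linear_between_mem[OF T a]])
      also have "\<dots> \<le> nrm (dual E) f * (nrm A a * K)"
        by (rule mult_left_mono[OF K(2)[OF a] dual_norm_nonneg[OF E f]])
      finally show "cmod (\<phi> a) \<le> nrm (dual E) f * K * nrm A a" using a by (simp add: \<phi>_def algebra_simps)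
    qed (simp_all add: \<phi>_def normed_space_add_mem[OF A] normed_space_scale_mem[OF A] linear_between_mem[OF T]
        linear_between_add[OF T] linear_between_scale[OF T] dual_add[OF f] dual_scale[OF f])
    then have "continuous_map (weak_topology (carr A) P) euclidean \<phi>"
      using P by (intro continuous_map_weak_topology_functional) simp
    then show "continuous_map (weak_topology (carr A) P) euclidean (\<lambda>a. f (T a))"
      by (rule continuous_map_eq) (simp add: topspace_weak_topology \<phi>_def)
  qed
  have "continuous_map (weak_topology (carr A) P) (weak_topology (carr E) (carr (dual E))) (\<lambda>a. lact E a x)"
    "continuous_map (weak_topology (carr A) P) (weak_topology (carr E) (carr (dual E))) (\<lambda>a. ract E x a)"
    if "x \<in> carr E" for x
    using M that nrm_nonneg[OF E that] by (auto intro!: cont[where K = "nrm E x"] simp: normed_bimodule_def)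
  then have "{x \<in> carr E.
        continuous_map (weak_topology (carr A) P) (weak_topology (carr E) (carr (dual E)))
          (\<lambda>a. lact E a x) \<and>
        continuous_map (weak_topology (carr A) P) (weak_topology (carr E) (carr (dual E)))
          (\<lambda>a. ract E x a)} = carr E"
    by blast
  then show ?thesis by (simp add: sigma_wc_def)
qed

lemma linear_between_id: "linear_between E E (\<lambda>x. x)"
  by (simp add: linear_between_def)

lemma banach_algebra_normed_space: "banach_algebra A \<Longrightarrow> normed_space A"
  by (simp add: banach_algebra_def banach_space_def)

section \<open>The tensor square of a Banach algebra as a bimodule\<close>

context
  fixes A :: "('a::complex_vector, 'x) nalgebra_scheme"
  assumes banach: "banach_algebra A"
begin

lemmas banach_normed = banach_algebra_normed_space[OF banach]

lemma banach_mult_left: "a \<in> carr A \<Longrightarrow> linear_between A A (mult A a)"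
  and banach_mult_right: "b \<in> carr A \<Longrightarrow> linear_between A A (\<lambda>a. mult A a b)"
  and banach_mult_norm: "a \<in> carr A \<Longrightarrow> b \<in> carr A \<Longrightarrow> nrm A (mult A a b) \<le> nrm A a * nrm A b"
  using banach by (auto simp: banach_algebra_def)

lemma banach_mult_norm': "a \<in> carr A \<Longrightarrow> b \<in> carr A \<Longrightarrow> nrm A (mult A b a) \<le> nrm A a * nrm A b"
  using banach_mult_norm[of b a] by (simp add: mult.commute)

text \<open>Identifies the described action with (b |-> ab) \<otimes> id, which makes its norm bound
  and its values on forms accessible.\<close>

lemma lact_tensor_bimodule:
  assumes a: "a \<in> carr A"
  shows "lact (tensor_bimodule A) a = tensor_map A A A A (mult A a) (\<lambda>c. c)"
proof -
  have "tensor_lift A A (proj_tensor A A) (\<lambda>b c. elem_tensor A A (mult A a b) c) =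
      tensor_map A A A A (mult A a) (\<lambda>c. c)"
  proof (rule tensor_lift_eqI[OF banach_normed banach_normed normed_space_proj_tensor[OF banach_normed banach_normed]])
    show "tensor_map A A A A (mult A a) (\<lambda>c. c) \<in> bounded_ops (proj_tensor A A) (proj_tensor A A)"
      by (rule tensor_map_bounded_ops[OF banach_normed banach_normed banach_normed banach_normed banach_mult_left[OF a] linear_between_id
            nrm_nonneg[OF banach_normed a] banach_mult_norm[OF a] zero_le_one]) simp_all
    show "tensor_map A A A A (mult A a) (\<lambda>c. c) (elem_tensor A A b c) = elem_tensor A A (mult A a b) c"
      if "b \<in> carr A" "c \<in> carr A" for b c
      by (rule tensor_map_elem[OF banach_normed banach_normed banach_normed banach_normed banach_mult_left[OF a] linear_between_id
            nrm_nonneg[OF banach_normed a] banach_mult_norm[OF a] zero_le_one _ that]) simp_all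
  qed
  then show ?thesis by (simp add: tensor_bimodule_def)
qed

lemma ract_tensor_bimodule:
  assumes a: "a \<in> carr A"
  shows "ract (tensor_bimodule A) u a = tensor_map A A A A (\<lambda>b. b) (\<lambda>c. mult A c a) u"
proof -
  have "tensor_lift A A (proj_tensor A A) (\<lambda>b c. elem_tensor A A b (mult A c a)) =
      tensor_map A A A A (\<lambda>b. b) (\<lambda>c. mult A c a)"
  proof (rule tensor_lift_eqI[OF banach_normed banach_normed normed_space_proj_tensor[OF banach_normed banach_normed]])
    show "tensor_map A A A A (\<lambda>b. b) (\<lambda>c. mult A c a) \<in> bounded_ops (proj_tensor A A) (proj_tensor A A)"
      by (rule tensor_map_bounded_ops[OF banach_normed banach_normed banach_normed banach_normed linear_between_id banach_mult_right[OF a]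
            zero_le_one _ nrm_nonneg[OF banach_normed a] banach_mult_norm'[OF a]]) simp_all
    show "tensor_map A A A A (\<lambda>b. b) (\<lambda>c. mult A c a) (elem_tensor A A b c) = elem_tensor A A b (mult A c a)"
      if "b \<in> carr A" "c \<in> carr A" for b c
      by (rule tensor_map_elem[OF banach_normed banach_normed banach_normed banach_normed linear_between_id banach_mult_right[OF a]
            zero_le_one _ nrm_nonneg[OF banach_normed a] banach_mult_norm'[OF a] that]) simp_all
  qed
  then show ?thesis by (simp add: tensor_bimodule_def)
qed

lemma lact_elem_tensor:
  assumes "a \<in> carr A" "b \<in> carr A" "c \<in> carr A"
  shows "lact (tensor_bimodule A) a (elem_tensor A A b c) = elem_tensor A A (mult A a b) c"
  unfolding lact_tensor_bimodule[OF assms(1)]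
  by (rule tensor_map_elem[OF banach_normed banach_normed banach_normed banach_normed banach_mult_left[OF assms(1)] linear_between_id
        nrm_nonneg[OF banach_normed assms(1)] banach_mult_norm[OF assms(1)] zero_le_one _ assms(2,3)]) simp_all

lemma ract_elem_tensor:
  assumes "a \<in> carr A" "b \<in> carr A" "c \<in> carr A"
  shows "ract (tensor_bimodule A) (elem_tensor A A b c) a = elem_tensor A A b (mult A c a)"
  unfolding ract_tensor_bimodule[OF assms(1)]
  by (rule tensor_map_elem[OF banach_normed banach_normed banach_normed banach_normed linear_between_id banach_mult_right[OF assms(1)]
        zero_le_one _ nrm_nonneg[OF banach_normed assms(1)] banach_mult_norm'[OF assms(1)] assms(2,3)]) simp_all

lemma carr_tensor_bimodule: "carr (tensor_bimodule A) = carr (proj_tensor A A)"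
  and nrm_tensor_bimodule: "nrm (tensor_bimodule A) = nrm (proj_tensor A A)"
  by (simp_all add: tensor_bimodule_def)

lemma normed_space_tensor_bimodule: "normed_space (tensor_bimodule A)"
  using normed_space_proj_tensor[OF banach_normed banach_normed]
    normed_space_cong[OF carr_tensor_bimodule nrm_tensor_bimodule] by simp

lemma dual_tensor_bimodule: "dual (tensor_bimodule A) = dual (proj_tensor A A)"
  by (rule dual_cong[OF carr_tensor_bimodule nrm_tensor_bimodule])

text \<open>Linearity in the tensor and the norm bounds are properties of \<open>tensor_map\<close>.
  Linearity in the algebra element is checked form by form, where it reduces to linearity of B in
  one variable.\<close>

lemma normed_bimodule_tensor: "normed_bimodule A (tensor_bimodule A)"
proof -
  let ?T = "tensor_bimodule A" and ?P = "proj_tensor A A"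
  have lops: "lact ?T a \<in> bounded_ops ?P ?P" if a: "a \<in> carr A" for a
    unfolding lact_tensor_bimodule[OF a]
    by (rule tensor_map_bounded_ops[OF banach_normed banach_normed banach_normed banach_normed banach_mult_left[OF a] linear_between_id
          nrm_nonneg[OF banach_normed a] banach_mult_norm[OF a] zero_le_one]) simp_all
  have rops: "(\<lambda>u. ract ?T u a) \<in> bounded_ops ?P ?P" if a: "a \<in> carr A" for a
    unfolding ract_tensor_bimodule[OF a]
    by (rule tensor_map_bounded_ops[OF banach_normed banach_normed banach_normed banach_normed linear_between_id banach_mult_right[OF a]
          zero_le_one _ nrm_nonneg[OF banach_normed a] banach_mult_norm'[OF a]]) simp_all
  have lform: "(\<lambda>x y. B (mult A a x) y) \<in> bilinear_forms A A" if "B \<in> bilinear_forms A A" "a \<in> carr A" for B a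
    by (rule tensor_map_form[OF banach_normed banach_normed banach_normed banach_normed banach_mult_left[OF that(2)] linear_between_id
          nrm_nonneg[OF banach_normed that(2)] banach_mult_norm[OF that(2)] zero_le_one _ that(1)]) simp_all
  have rform: "(\<lambda>x y. B x (mult A y a)) \<in> bilinear_forms A A" if "B \<in> bilinear_forms A A" "a \<in> carr A" for B a
    by (rule tensor_map_form[OF banach_normed banach_normed banach_normed banach_normed linear_between_id banach_mult_right[OF that(2)]
          zero_le_one _ nrm_nonneg[OF banach_normed that(2)] banach_mult_norm'[OF that(2)] that(1)]) simp_all
  have lnorm: "nrm ?P (lact ?T a u) \<le> nrm A a * nrm ?P u" if a: "a \<in> carr A" and u: "u \<in> carr ?P" for a u
    using tensor_map_norm_le[OF banach_normed banach_normed banach_normed banach_normed banach_mult_left[OF a] linear_between_id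
          nrm_nonneg[OF banach_normed a] banach_mult_norm[OF a] zero_le_one _ u]
    by (simp add: lact_tensor_bimodule[OF a])
  have rnorm: "nrm ?P (ract ?T u a) \<le> nrm A a * nrm ?P u" if a: "a \<in> carr A" and u: "u \<in> carr ?P" for a u
    using tensor_map_norm_le[OF banach_normed banach_normed banach_normed banach_normed linear_between_id banach_mult_right[OF a]
          zero_le_one _ nrm_nonneg[OF banach_normed a] banach_mult_norm'[OF a] u]
    by (simp add: ract_tensor_bimodule[OF a])
  have ladd: "lact ?T (a + a') u = lact ?T a u + lact ?T a' u"
    and radd: "ract ?T u (a + a') = ract ?T u a + ract ?T u a'"
    if u: "u \<in> carr ?P" and a: "a \<in> carr A" "a' \<in> carr A" for u a a'
  proof -
    have "u (\<lambda>x y. B (mult A (a + a') x) y) = u (\<lambda>x y. B (mult A a x) y) + u (\<lambda>x y. B (mult A a' x) y)"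
      if B: "B \<in> bilinear_forms A A" for B
      unfolding tensor_form_add[OF banach_normed banach_normed u lform[OF B a(1)] lform[OF B a(2)], symmetric]
      by (rule tensor_form_cong[OF banach_normed banach_normed u])
        (simp add: linear_between_add[OF banach_mult_right] linear_between_mem[OF banach_mult_right]
          bilinear_forms_add_left[OF B] a)
    then show "lact ?T (a + a') u = lact ?T a u + lact ?T a' u"
      using u by (auto simp: fun_eq_iff lact_tensor_bimodule a normed_space_add_mem[OF banach_normed] tensor_map_def)
    have "u (\<lambda>x y. B x (mult A y (a + a'))) = u (\<lambda>x y. B x (mult A y a)) + u (\<lambda>x y. B x (mult A y a'))"
      if B: "B \<in> bilinear_forms A A" for B
      unfolding tensor_form_add[OF banach_normed banach_normed u rform[OF B a(1)] rform[OF B a(2)], symmetric]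
      by (rule tensor_form_cong[OF banach_normed banach_normed u])
        (simp add: linear_between_add[OF banach_mult_left] linear_between_mem[OF banach_mult_left]
          bilinear_forms_add_right[OF B] a)
    then show "ract ?T u (a + a') = ract ?T u a + ract ?T u a'"
      using u by (auto simp: fun_eq_iff ract_tensor_bimodule a normed_space_add_mem[OF banach_normed] tensor_map_def)
  qed
  have lscale: "lact ?T (k *\<^sub>C a) u = k *\<^sub>C lact ?T a u"
    and rscale: "ract ?T u (k *\<^sub>C a) = k *\<^sub>C ract ?T u a"
    if u: "u \<in> carr ?P" and a: "a \<in> carr A" for u a k
  proof -
    have "u (\<lambda>x y. B (mult A (k *\<^sub>C a) x) y) = k * u (\<lambda>x y. B (mult A a x) y)"
      if B: "B \<in> bilinear_forms A A" for B
      unfolding tensor_form_scale[OF banach_normed banach_normed u lform[OF B a], symmetric]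
      by (rule tensor_form_cong[OF banach_normed banach_normed u])
        (simp add: linear_between_scale[OF banach_mult_right] linear_between_mem[OF banach_mult_right]
          bilinear_forms_scale_left[OF B] a)
    then show "lact ?T (k *\<^sub>C a) u = k *\<^sub>C lact ?T a u"
      using u by (auto simp: fun_eq_iff lact_tensor_bimodule a normed_space_scale_mem[OF banach_normed] tensor_map_def scaleC_apply)
    have "u (\<lambda>x y. B x (mult A y (k *\<^sub>C a))) = k * u (\<lambda>x y. B x (mult A y a))"
      if B: "B \<in> bilinear_forms A A" for B
      unfolding tensor_form_scale[OF banach_normed banach_normed u rform[OF B a], symmetric]
      by (rule tensor_form_cong[OF banach_normed banach_normed u])
        (simp add: linear_between_scale[OF banach_mult_left] linear_between_mem[OF banach_mult_left]
          bilinear_forms_scale_right[OF B] a)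
    then show "ract ?T u (k *\<^sub>C a) = k *\<^sub>C ract ?T u a"
      using u by (auto simp: fun_eq_iff ract_tensor_bimodule a normed_space_scale_mem[OF banach_normed] tensor_map_def scaleC_apply)
  qed
  show ?thesis
    unfolding normed_bimodule_def linear_between_def
    using normed_space_tensor_bimodule lops rops ladd radd lscale rscale lnorm rnorm
    by (auto simp: carr_tensor_bimodule nrm_tensor_bimodule bounded_ops_iff linear_between_def Pi_iff)
qed

text \<open>\<open>pi_sigma_wc\<close> involves the inverse of the canonical map. With P the whole
  dual, m composed with the adjoint of the product morphism is a bounded functional on
  \<open>dual A\<close>, hence evaluation at a unique point by \<open>bij\<close>; equality with a
  can then be tested on functionals, without the inverse.\<close>

lemma pi_sigma_wc_eq_iff:
  assumes P: "P = carr (dual A)"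
    and bij: "bij_betw (canonical_map P) (carr A) (carr (dual (predual_space A P)))"
    and pi: "product_morphism A \<in> bounded_ops (proj_tensor A A) A"
    and m: "m \<in> carr (dual (dual (proj_tensor A A)))" and a: "a \<in> carr A"
  shows "pi_sigma_wc A P m = a \<longleftrightarrow>
    (\<forall>\<phi>\<in>P. m (adjoint (tensor_bimodule A) (product_morphism A) \<phi>) = \<phi> a)"
proof -
  let ?T = "tensor_bimodule A"
  define g where "g = adjoint (predual_space A P) (adjoint ?T (product_morphism A)) m"
  have pd: "predual_space A P = dual A" by (simp add: predual_space_def P)
  have ad: "adjoint ?T f = adjoint (proj_tensor A A) f" for f :: "_ \<Rightarrow> 'a"
    by (simp add: adjoint_def fun_eq_iff carr_tensor_bimodule)
  note PP = normed_space_proj_tensor[OF banach_normed banach_normed]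
  have lin: "linear_between (dual A) (dual (proj_tensor A A)) (adjoint ?T (product_morphism A))"
    and bd: "bounded_between (dual A) (dual (proj_tensor A A)) (adjoint ?T (product_morphism A))"
    unfolding ad using pi linear_between_adjoint[OF PP banach_normed] by (auto simp: bounded_ops_iff)
  obtain K where K: "K \<ge> 0" "\<And>\<phi>. \<phi> \<in> carr (dual A) \<Longrightarrow>
      nrm (dual (proj_tensor A A)) (adjoint ?T (product_morphism A) \<phi>) \<le> K * nrm (dual A) \<phi>"
    using bounded_betweenE[OF bd normed_space_dual[OF banach_normed]] by blast
  have "g \<in> carr (dual (predual_space A P))"
    unfolding g_def pd by (rule adjoint_mem[OF normed_space_dual[OF banach_normed] normed_space_dual[OF PP] lin K m])
  then obtain b where b: "b \<in> carr A" "g = canonical_map P b"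
    using bij by (auto simp: bij_betw_def)
  have inj: "inj_on (canonical_map P) (carr A)" using bij by (simp add: bij_betw_def)
  have "pi_sigma_wc A P m = b"
    using the_inv_into_f_f[OF inj b(1)] b(2) by (simp add: pi_sigma_wc_def g_def)
  then have "pi_sigma_wc A P m = a \<longleftrightarrow> g = canonical_map P a"
    using inj b a by (auto simp: inj_on_def)
  also have "\<dots> \<longleftrightarrow> (\<forall>\<phi>\<in>P. m (adjoint ?T (product_morphism A) \<phi>) = \<phi> a)"
    unfolding g_def pd by (auto simp: fun_eq_iff adjoint_def[of "dual A"] canonical_map_def P)
  finally show ?thesis .
qed

lemma sigma_wc_bidual_reflexive:
  assumes "P = carr (dual A)"
  shows "sigma_wc_bidual A P = dual_bimodule (dual_bimodule (tensor_bimodule A))"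
  unfolding sigma_wc_bidual_def
  using sigma_wc_reflexive[OF banach_normed normed_bimodule_dual[OF banach_normed normed_bimodule_tensor] assms]
  by simp

end

section \<open>Duality for square-summable functions\<close>

lemma carr_l2_iff:
  "x \<in> carr (l2 S) \<longleftrightarrow> (\<lambda>s. (cmod (x s))\<^sup>2) summable_on S \<and> (\<forall>s. s \<notin> S \<longrightarrow> x s = 0)"
  by (simp add: l2_def)

lemma l2_outside: "x \<in> carr (l2 S) \<Longrightarrow> s \<notin> S \<Longrightarrow> x s = 0"
  by (simp add: carr_l2_iff)

lemma mult_l2: "mult (l2 S) = (\<lambda>x y. x * y)"
  by (simp add: l2_def)

text \<open>Reduces square-summability and the norm bound to one estimate uniform over finite
  subsets. Most later membership proofs in l2(S) establish such an estimate and use it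
  twice.\<close>

lemma
  assumes le: "\<And>F. finite F \<Longrightarrow> F \<subseteq> S \<Longrightarrow> L2_set (\<lambda>s. cmod (x s)) F \<le> C"
    and out: "\<And>s. s \<notin> S \<Longrightarrow> x s = 0"
  shows l2_memI: "x \<in> carr (l2 S)" and l2_norm_le: "nrm (l2 S) x \<le> C"
proof -
  \<comment> \<open>The empty set already forces the sign.\<close>
  have C: "C \<ge> 0" using le[of "{}"] by simp
  have le2: "(\<Sum>s\<in>F. (cmod (x s))\<^sup>2) \<le> C\<^sup>2" if "finite F" "F \<subseteq> S" for F
    using le[OF that] by (intro sqrt_le_D) (simp add: L2_set_def)
  have sm: "(\<lambda>s. (cmod (x s))\<^sup>2) summable_on S"
    by (rule nonneg_bdd_above_summable_on) (auto intro!: bdd_aboveI[of _ "C\<^sup>2"] le2)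
  then show "x \<in> carr (l2 S)" using out by (simp add: carr_l2_iff)
  have "(\<Sum>\<^sub>\<infinity>s\<in>S. (cmod (x s))\<^sup>2) \<le> C\<^sup>2" by (rule infsum_le_finite_sums[OF sm le2])
  then show "nrm (l2 S) x \<le> C" using C by (simp add: l2_def real_le_lsqrt)
qed

lemma L2_set_le_l2_norm:
  assumes "x \<in> carr (l2 S)" "finite F" "F \<subseteq> S"
  shows "L2_set (\<lambda>s. cmod (x s)) F \<le> nrm (l2 S) x"
  using finite_sum_le_infsum[of "\<lambda>s. (cmod (x s))\<^sup>2" S F] assms
  by (simp add: L2_set_def l2_def)

lemma l2_norm_nonneg: "0 \<le> nrm (l2 S) x"
  by (simp add: l2_def infsum_nonneg)

lemma l2_coord_le:
  assumes "x \<in> carr (l2 S)"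
  shows "cmod (x s) \<le> nrm (l2 S) x"
  using L2_set_le_l2_norm[OF assms, of "{s}"] l2_outside[OF assms, of s] l2_norm_nonneg[of S x]
  by (cases "s \<in> S") simp_all

lemma l2_add:
  assumes x: "x \<in> carr (l2 S)" and y: "y \<in> carr (l2 S)"
  shows "x + y \<in> carr (l2 S)" "nrm (l2 S) (x + y) \<le> nrm (l2 S) x + nrm (l2 S) y"
proof -
  have le: "L2_set (\<lambda>s. cmod ((x + y) s)) F \<le> nrm (l2 S) x + nrm (l2 S) y" if "finite F" "F \<subseteq> S" for F
  proof -
    have "L2_set (\<lambda>s. cmod ((x + y) s)) F \<le> L2_set (\<lambda>s. cmod (x s) + cmod (y s)) F"
      by (rule L2_set_mono) (simp_all add: norm_triangle_ineq)
    also have "\<dots> \<le> L2_set (\<lambda>s. cmod (x s)) F + L2_set (\<lambda>s. cmod (y s)) F"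
      by (rule L2_set_triangle_ineq)
    finally show ?thesis
      using L2_set_le_l2_norm[OF x that] L2_set_le_l2_norm[OF y that] by linarith
  qed
  have out: "(x + y) s = 0" if "s \<notin> S" for s using l2_outside[OF x that] l2_outside[OF y that] by simp
  show "x + y \<in> carr (l2 S)" by (rule l2_memI[OF le out])
  show "nrm (l2 S) (x + y) \<le> nrm (l2 S) x + nrm (l2 S) y" by (rule l2_norm_le[OF le out])
qed

text \<open>Treats bounded multipliers at once: a constant c gives scalar multiplication, and an
  element of l2(S), whose coordinates are bounded by its norm, gives the algebra product.\<close>

lemma l2_mult_bounded:
  assumes x: "x \<in> carr (l2 S)" and C: "\<And>s. s \<in> S \<Longrightarrow> cmod (c s) \<le> C" "C \<ge> 0"
  shows "c * x \<in> carr (l2 S)" "nrm (l2 S) (c * x) \<le> C * nrm (l2 S) x"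
proof -
  have le: "L2_set (\<lambda>s. cmod ((c * x) s)) F \<le> C * nrm (l2 S) x" if F: "finite F" "F \<subseteq> S" for F
  proof -
    have "L2_set (\<lambda>s. cmod ((c * x) s)) F \<le> L2_set (\<lambda>s. C * cmod (x s)) F"
      by (rule L2_set_mono) (use C F in \<open>auto simp: norm_mult intro!: mult_right_mono\<close>)
    also have "\<dots> = C * L2_set (\<lambda>s. cmod (x s)) F" using C by (simp add: L2_set_right_distrib)
    finally show ?thesis using mult_left_mono[OF L2_set_le_l2_norm[OF x F] C(2)] by linarith
  qed
  have out: "(c * x) s = 0" if "s \<notin> S" for s using l2_outside[OF x that] by simp
  show "c * x \<in> carr (l2 S)" by (rule l2_memI[OF le out])
  show "nrm (l2 S) (c * x) \<le> C * nrm (l2 S) x" by (rule l2_norm_le[OF le out])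
qed

lemma scaleC_eq_mult: "c *\<^sub>C x = (\<lambda>_. c) * x" for x :: "'s \<Rightarrow> complex"
  by (simp add: fun_eq_iff scaleC_apply)

lemma normed_space_l2: "normed_space (l2 S)"
proof -
  have zero: "0 \<in> carr (l2 S)" "nrm (l2 S) 0 = 0" by (simp_all add: l2_def)
  have scale: "c *\<^sub>C x \<in> carr (l2 S)" if "x \<in> carr (l2 S)" for c x
    unfolding scaleC_eq_mult by (rule l2_mult_bounded[OF that, where C = "cmod c"]) simp_all
  have hom: "nrm (l2 S) (c *\<^sub>C x) = cmod c * nrm (l2 S) x" for c x
    by (simp add: l2_def scaleC_apply norm_mult power_mult_distrib infsum_cmult_right' real_sqrt_mult)
  have eq0: "x = 0" if x: "x \<in> carr (l2 S)" and "nrm (l2 S) x = 0" for x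
    using l2_coord_le[OF x] that(2) by (auto simp: fun_eq_iff)
  show ?thesis
    unfolding normed_space_def complex_vector.subspace_def
    using zero eq0 by (auto simp: hom scale l2_add l2_norm_nonneg)
qed

text \<open>Coordinates are dominated by the norm, so a Cauchy sequence converges pointwise. The
  Cauchy estimate survives the limit on finite subsets, which gives both membership of the limit and
  convergence in norm.\<close>

lemma banach_space_l2: "banach_space (l2 S)"
proof -
  interpret M: Metric_space "carr (l2 S)" "norm_dist (l2 S)"
    by (rule Metric_space_norm_dist[OF normed_space_l2])
  have "\<exists>x. limitin M.mtopology \<sigma> x sequentially" if "M.MCauchy \<sigma>" for \<sigma>
  proof -
    have mem: "\<sigma> n \<in> carr (l2 S)" for n using that by (auto simp: M.MCauchy_def)
    have diff: "\<sigma> m - \<sigma> n \<in> carr (l2 S)" for m n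
      by (rule normed_space_diff_mem[OF normed_space_l2 mem mem])
    have cauchy: "\<exists>N. \<forall>m\<ge>N. \<forall>n\<ge>N. nrm (l2 S) (\<sigma> m - \<sigma> n) < \<epsilon>" if "\<epsilon> > 0" for \<epsilon>
    proof -
      have "\<exists>N. \<forall>m n. N \<le> m \<longrightarrow> N \<le> n \<longrightarrow> norm_dist (l2 S) (\<sigma> m) (\<sigma> n) < \<epsilon>"
        using \<open>M.MCauchy \<sigma>\<close> that by (simp add: M.MCauchy_def)
      then show ?thesis using mem by (auto simp: norm_dist_def)
    qed
    have "Cauchy (\<lambda>n. \<sigma> n s)" for s
    proof (rule CauchyI)
      fix \<epsilon> :: real assume "\<epsilon> > 0"
      then obtain N where "\<forall>m\<ge>N. \<forall>n\<ge>N. nrm (l2 S) (\<sigma> m - \<sigma> n) < \<epsilon>" using cauchy by blast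
      then show "\<exists>N. \<forall>m\<ge>N. \<forall>n\<ge>N. norm (\<sigma> m s - \<sigma> n s) < \<epsilon>"
        using l2_coord_le[OF diff, of _ _ s] by (simp, metis order_le_less_trans)
    qed
    then have lim: "(\<lambda>n. \<sigma> n s) \<longlonglongrightarrow> lim (\<lambda>n. \<sigma> n s)" for s
      by (simp add: Cauchy_convergent_iff convergent_LIMSEQ_iff)
    define x where "x s = lim (\<lambda>n. \<sigma> n s)" for s
    have out: "x s = 0" if "s \<notin> S" for s
      using l2_outside[OF mem that] by (simp add: x_def)
    have close: "\<exists>N. \<forall>n\<ge>N. \<sigma> n - x \<in> carr (l2 S) \<and> nrm (l2 S) (\<sigma> n - x) \<le> \<epsilon>" if "\<epsilon> > 0" for \<epsilon>
    proof -
      obtain N where N: "\<forall>m\<ge>N. \<forall>n\<ge>N. nrm (l2 S) (\<sigma> m - \<sigma> n) < \<epsilon>" using cauchy[OF \<open>\<epsilon> > 0\<close>] by blast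
      \<comment> \<open>Over a finite F the norm is a continuous function of finitely many
        coordinates, so n can tend to infinity; the bound does not depend on F.\<close>
      have le: "L2_set (\<lambda>s. cmod ((\<sigma> m - x) s)) F \<le> \<epsilon>" if "m \<ge> N" and F: "finite F" "F \<subseteq> S" for m F
      proof (rule LIMSEQ_le_const2)
        show "(\<lambda>n. L2_set (\<lambda>s. cmod ((\<sigma> m - \<sigma> n) s)) F) \<longlonglongrightarrow> L2_set (\<lambda>s. cmod ((\<sigma> m - x) s)) F"
          unfolding L2_set_def fun_diff_def x_def
          by (intro tendsto_intros lim)
        show "\<exists>N. \<forall>n\<ge>N. L2_set (\<lambda>s. cmod ((\<sigma> m - \<sigma> n) s)) F \<le> \<epsilon>"
          using N that(1) L2_set_le_l2_norm[OF diff F] by (meson less_imp_le order_trans)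
      qed
      have "(\<sigma> m - x) s = 0" if "s \<notin> S" for m s using l2_outside[OF mem that] out[OF that] by simp
      then show ?thesis using l2_memI[OF le] l2_norm_le[OF le] by blast
    qed
    \<comment> \<open>The limit is recovered as \<open>\<sigma> N - (\<sigma> N - x)\<close>, a
      difference of two members.\<close>
    obtain N where "\<sigma> N - x \<in> carr (l2 S)" using close[of 1] by auto
    from normed_space_diff_mem[OF normed_space_l2 mem[of N] this]
    have x: "x \<in> carr (l2 S)" by simp
    \<comment> \<open>Using half of \<epsilon> restores the strict inequality that was lost in the
      limit.\<close>
    have "\<exists>N. \<forall>n\<ge>N. nrm (l2 S) (\<sigma> n - x) < \<epsilon>" if "\<epsilon> > 0" for \<epsilon>
      using close[of "\<epsilon> / 2"] that by (metis field_sum_of_halves half_gt_zero less_add_same_cancel1 order_le_less_trans)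
    then have "limitin M.mtopology \<sigma> x sequentially"
      using x mem by (simp add: M.limit_metric_sequentially norm_dist_def)
    then show ?thesis by blast
  qed
  then show ?thesis using normed_space_l2 by (auto simp: banach_space_def M.mcomplete_def)
qed

lemma l2_mult:
  assumes "x \<in> carr (l2 S)" "y \<in> carr (l2 S)"
  shows "x * y \<in> carr (l2 S)" "nrm (l2 S) (x * y) \<le> nrm (l2 S) x * nrm (l2 S) y"
  using l2_mult_bounded[OF assms(2) l2_coord_le[OF assms(1)] l2_norm_nonneg] by auto

lemma banach_algebra_l2: "banach_algebra (l2 S)"
  using banach_space_l2 l2_mult
  by (auto simp: banach_algebra_def linear_between_def mult_l2 fun_eq_iff scaleC_apply algebra_simps)

text \<open>The Cauchy-Schwarz inequality on finite subsets bounds the absolute sums uniformly,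
  which yields absolute summability and the estimate together.\<close>

lemma
  assumes x: "x \<in> carr (l2 S)" and y: "y \<in> carr (l2 S)"
  shows l2_pairing_summable: "(\<lambda>s. x s * y s) summable_on S"
    and l2_pairing_bound: "cmod (\<Sum>\<^sub>\<infinity>s\<in>S. x s * y s) \<le> nrm (l2 S) x * nrm (l2 S) y"
proof -
  have le: "(\<Sum>s\<in>F. cmod (x s * y s)) \<le> nrm (l2 S) x * nrm (l2 S) y" if F: "finite F" "F \<subseteq> S" for F
  proof -
    have "(\<Sum>s\<in>F. cmod (x s * y s)) \<le> L2_set (\<lambda>s. cmod (x s)) F * L2_set (\<lambda>s. cmod (y s)) F"
      using L2_set_mult_ineq[of "\<lambda>s. cmod (x s)" "\<lambda>s. cmod (y s)" F] by (simp add: norm_mult)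
    also have "\<dots> \<le> nrm (l2 S) x * nrm (l2 S) y"
      by (intro mult_mono L2_set_le_l2_norm x y F l2_norm_nonneg L2_set_nonneg)
    finally show ?thesis .
  qed
  have abs: "(\<lambda>s. norm (x s * y s)) summable_on S"
    by (rule nonneg_bdd_above_summable_on) (auto intro!: bdd_aboveI[of _ "nrm (l2 S) x * nrm (l2 S) y"] le)
  then show "(\<lambda>s. x s * y s) summable_on S" by (rule abs_summable_summable)
  show "cmod (\<Sum>\<^sub>\<infinity>s\<in>S. x s * y s) \<le> nrm (l2 S) x * nrm (l2 S) y"
    using norm_infsum_bound[OF abs] infsum_le_finite_sums[OF abs le] by linarith
qed

section \<open>The bilinear pairing, finite truncations and the Riesz representation\<close>

definition l2_functional :: "'s set \<Rightarrow> ('s \<Rightarrow> complex) \<Rightarrow> ('s \<Rightarrow> complex) \<Rightarrow> complex" where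
  "l2_functional S y = (\<lambda>x. if x \<in> carr (l2 S) then \<Sum>\<^sub>\<infinity>s\<in>S. x s * y s else 0)"

lemma l2_predual_eq: "l2_predual S = l2_functional S ` carr (l2 S)"
  by (auto simp: l2_predual_def l2_functional_def)

lemma l2_functional_commute:
  "x \<in> carr (l2 S) \<Longrightarrow> y \<in> carr (l2 S) \<Longrightarrow> l2_functional S y x = l2_functional S x y"
  by (simp add: l2_functional_def mult.commute)

lemma
  assumes y: "y \<in> carr (l2 S)"
  shows l2_functional_mem: "l2_functional S y \<in> carr (dual (l2 S))"
    and l2_functional_norm_le: "nrm (dual (l2 S)) (l2_functional S y) \<le> nrm (l2 S) y"
proof -
  have le: "cmod (l2_functional S y x) \<le> nrm (l2 S) y * nrm (l2 S) x" if "x \<in> carr (l2 S)" for x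
    using l2_pairing_bound[OF that y] that by (simp add: l2_functional_def mult.commute)
  show "l2_functional S y \<in> carr (dual (l2 S))"
    by (rule dual_memI[OF _ _ le])
      (simp_all add: l2_functional_def normed_space_add_mem[OF normed_space_l2]
        normed_space_scale_mem[OF normed_space_l2] distrib_right infsum_add l2_pairing_summable y
        scaleC_apply mult.assoc infsum_cmult_right')
  show "nrm (dual (l2 S)) (l2_functional S y) \<le> nrm (l2 S) y"
    by (rule dual_norm_le[OF normed_space_l2 l2_norm_nonneg le])
qed

definition l2_unit :: "'s \<Rightarrow> 's \<Rightarrow> complex" where
  "l2_unit s = (\<lambda>t. if t = s then 1 else 0)"

definition l2_restrict :: "'s set \<Rightarrow> ('s \<Rightarrow> complex) \<Rightarrow> 's \<Rightarrow> complex" where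
  "l2_restrict F x = (\<lambda>s. if s \<in> F then x s else 0)"

text \<open>The function x is arbitrary, since only finitely many values matter. This covers unit
  vectors, indicator functions and the conjugated coefficients used as test vectors.\<close>

lemma
  assumes "finite F" "F \<subseteq> S"
  shows l2_restrict_mem: "l2_restrict F x \<in> carr (l2 S)"
    and l2_restrict_norm_le: "nrm (l2 S) (l2_restrict F x) \<le> L2_set (\<lambda>s. cmod (x s)) F"
proof -
  have le: "L2_set (\<lambda>s. cmod (l2_restrict F x s)) G \<le> L2_set (\<lambda>s. cmod (x s)) F" if G: "finite G" for G
  proof -
    have "(\<Sum>s\<in>G. (cmod (l2_restrict F x s))\<^sup>2) = (\<Sum>s\<in>G \<inter> F. (cmod (x s))\<^sup>2)"
      unfolding l2_restrict_def sum.inter_restrict[OF G] by (rule sum.cong) auto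
    also have "\<dots> \<le> (\<Sum>s\<in>F. (cmod (x s))\<^sup>2)" using assms(1) by (intro sum_mono2) auto
    finally show ?thesis by (simp add: L2_set_def)
  qed
  have out: "l2_restrict F x s = 0" if "s \<notin> S" for s using assms that by (auto simp: l2_restrict_def)
  show "l2_restrict F x \<in> carr (l2 S)" by (rule l2_memI[OF le out])
  show "nrm (l2 S) (l2_restrict F x) \<le> L2_set (\<lambda>s. cmod (x s)) F" by (rule l2_norm_le[OF le out])
qed

lemma l2_unit_mem: "s \<in> S \<Longrightarrow> l2_unit s \<in> carr (l2 S)"
  using l2_restrict_mem[of "{s}" S "\<lambda>_. 1"] by (simp add: l2_restrict_def l2_unit_def[abs_def])

lemma l2_unit_outside: "s \<notin> S \<Longrightarrow> l2_unit s \<notin> carr (l2 S)"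
  using l2_outside[of "l2_unit s" S s] by (auto simp: l2_unit_def)

lemma l2_restrict_sum: "finite F \<Longrightarrow> l2_restrict F x = (\<Sum>s\<in>F. x s *\<^sub>C l2_unit s)"
proof (induction F rule: finite_induct)
  case (insert s F)
  have "l2_restrict (insert s F) x = x s *\<^sub>C l2_unit s + l2_restrict F x"
    using insert(2) by (auto simp: fun_eq_iff l2_restrict_def l2_unit_def scaleC_apply)
  then show ?case using insert by simp
qed (simp add: l2_restrict_def fun_eq_iff)

lemma l2_functional_unit:
  assumes "s \<in> S" "x \<in> carr (l2 S)"
  shows "l2_functional S (l2_unit s) x = x s"
  using infsum_cong_neutral[of "{s}" S "\<lambda>t. x t * l2_unit s t" "\<lambda>t. x t * l2_unit s t"] assms
  by (simp add: l2_functional_def l2_unit_def)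

text \<open>The squared distance is the sum over S - F, that is, the full sum minus a partial
  sum.\<close>

lemma l2_restrict_tendsto:
  assumes x: "x \<in> carr (l2 S)"
  shows "((\<lambda>F. nrm (l2 S) (l2_restrict F x - x)) \<longlongrightarrow> 0) (finite_subsets_at_top S)"
proof -
  have sm: "(\<lambda>s. (cmod (x s))\<^sup>2) summable_on S" using x by (simp add: carr_l2_iff)
  have eq: "nrm (l2 S) (l2_restrict F x - x) = sqrt ((\<Sum>\<^sub>\<infinity>s\<in>S. (cmod (x s))\<^sup>2) - (\<Sum>s\<in>F. (cmod (x s))\<^sup>2))"
    if F: "finite F" "F \<subseteq> S" for F
  proof -
    have "(\<Sum>\<^sub>\<infinity>s\<in>S. (cmod ((l2_restrict F x - x) s))\<^sup>2) = (\<Sum>\<^sub>\<infinity>s\<in>S - F. (cmod (x s))\<^sup>2)"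
      by (rule infsum_cong_neutral) (auto simp: l2_restrict_def)
    also have "\<dots> = (\<Sum>\<^sub>\<infinity>s\<in>S. (cmod (x s))\<^sup>2) - (\<Sum>\<^sub>\<infinity>s\<in>F. (cmod (x s))\<^sup>2)"
      by (rule infsum_Diff[OF sm _ F(2)]) (simp add: F summable_on_finite)
    finally show ?thesis using F by (simp add: l2_def)
  qed
  have "((\<lambda>F. sqrt ((\<Sum>\<^sub>\<infinity>s\<in>S. (cmod (x s))\<^sup>2) - (\<Sum>s\<in>F. (cmod (x s))\<^sup>2))) \<longlongrightarrow>
      sqrt ((\<Sum>\<^sub>\<infinity>s\<in>S. (cmod (x s))\<^sup>2) - (\<Sum>\<^sub>\<infinity>s\<in>S. (cmod (x s))\<^sup>2))) (finite_subsets_at_top S)"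
    by (intro tendsto_intros infsum_tendsto[OF sm])
  moreover have "\<forall>\<^sub>F F in finite_subsets_at_top S. nrm (l2 S) (l2_restrict F x - x) =
      sqrt ((\<Sum>\<^sub>\<infinity>s\<in>S. (cmod (x s))\<^sup>2) - (\<Sum>s\<in>F. (cmod (x s))\<^sup>2))"
    by (rule eventually_finite_subsets_at_top_weakI) (rule eq)
  ultimately show ?thesis by (simp add: tendsto_cong)
qed

text \<open>By linearity the difference vanishes on all finite truncations of x; these converge to x
  in norm, and boundedness carries the value 0 over.\<close>

lemma l2_dual_eqI:
  assumes f: "f \<in> carr (dual (l2 S))" and g: "g \<in> carr (dual (l2 S))"
    and eq: "\<And>s. s \<in> S \<Longrightarrow> f (l2_unit s) = g (l2_unit s)"
  shows "f = g"
proof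
  fix x
  show "f x = g x"
  proof (cases "x \<in> carr (l2 S)")
    case True
    let ?D = "dual (l2 S)"
    note D = normed_space_dual[OF normed_space_l2, of S]
    have h: "f - g \<in> carr ?D" by (rule normed_space_diff_mem[OF D f g])
    then have lin: "linear_between (l2 S) complex_space (f - g)" by (simp add: carr_dual_iff)
    have r: "(f - g) (l2_restrict F x) = 0" if F: "finite F" "F \<subseteq> S" for F
    proof -
      have "(f - g) (l2_restrict F x) = (\<Sum>s\<in>F. (f - g) (x s *\<^sub>C l2_unit s))"
        unfolding l2_restrict_sum[OF F(1)]
        using F by (intro linear_between_sum[OF lin normed_space_l2]
            normed_space_scale_mem[OF normed_space_l2] l2_unit_mem) auto
      also have "\<dots> = 0"
        using F eq by (intro sum.neutral) (auto simp: dual_scale[OF f] dual_scale[OF g] l2_unit_mem subset_iff)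
      finally show ?thesis .
    qed
    have "cmod ((f - g) x) \<le> nrm ?D (f - g) * nrm (l2 S) (l2_restrict F x - x)" if F: "finite F" "F \<subseteq> S" for F
    proof -
      note rm = l2_restrict_mem[OF F, of x]
      have "(f - g) (l2_restrict F x - x) = - ((f - g) x)"
        using linear_between_diff[OF lin normed_space_l2 rm True] r[OF F] by simp
      then show ?thesis
        using dual_norm_bound[OF normed_space_l2 h normed_space_diff_mem[OF normed_space_l2 rm True]]
        by (metis norm_minus_cancel)
    qed
    then have "cmod ((f - g) x) \<le> nrm ?D (f - g) * 0"
      by (intro tendsto_lowerbound[OF tendsto_mult_left[OF l2_restrict_tendsto[OF True]]])
        (auto intro!: eventually_finite_subsets_at_top_weakI)
    then show ?thesis by simp
  qed (simp add: dual_outside[OF f] dual_outside[OF g])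
qed

text \<open>The coefficients can only be the values at the unit vectors. Square-summability follows
  by testing f on vectors made from these coefficients, and agreement on unit vectors determines a
  bounded functional.\<close>

lemma l2_riesz:
  assumes f: "f \<in> carr (dual (l2 S))"
  defines "y \<equiv> \<lambda>s. f (l2_unit s)"
  shows "y \<in> carr (l2 S)" "nrm (l2 S) y \<le> nrm (dual (l2 S)) f" "f = l2_functional S y"
proof -
  have lin: "linear_between (l2 S) complex_space f" using f by (simp add: carr_dual_iff)
  have le: "L2_set (\<lambda>s. cmod (y s)) F \<le> nrm (dual (l2 S)) f" if F: "finite F" "F \<subseteq> S" for F
  proof -
    define L where "L = L2_set (\<lambda>s. cmod (y s)) F"
    \<comment> \<open>Conjugation is needed because the pairing is bilinear: it makes
      \<open>f z\<close> the sum of the squared moduli, which is \<open>L\<^sup>2\<close>, while z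
      has norm at most L.\<close>
    define z where "z = l2_restrict F (\<lambda>s. cnj (y s))"
    have z: "z \<in> carr (l2 S)" "nrm (l2 S) z \<le> L"
      using l2_restrict_mem[OF F] l2_restrict_norm_le[OF F, of "\<lambda>s. cnj (y s)"] by (simp_all add: z_def L_def)
    have "f z = (\<Sum>s\<in>F. f (cnj (y s) *\<^sub>C l2_unit s))"
      unfolding z_def l2_restrict_sum[OF F(1)]
      using F by (intro linear_between_sum[OF lin normed_space_l2]
          normed_space_scale_mem[OF normed_space_l2] l2_unit_mem) auto
    also have "\<dots> = (\<Sum>s\<in>F. cnj (y s) * y s)"
      using F by (intro sum.cong) (auto simp: dual_scale[OF f] l2_unit_mem subset_iff y_def)
    also have "\<dots> = complex_of_real (\<Sum>s\<in>F. (cmod (y s))\<^sup>2)"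
      by (simp add: complex_norm_square mult.commute flip: of_real_power)
    also have "\<dots> = complex_of_real (L\<^sup>2)" by (simp add: L_def L2_set_def sum_nonneg)
    finally have "L\<^sup>2 \<le> nrm (dual (l2 S)) f * nrm (l2 S) z"
      using dual_norm_bound[OF normed_space_l2 f z(1)] by (simp add: norm_power)
    also have "\<dots> \<le> nrm (dual (l2 S)) f * L"
      by (rule mult_left_mono[OF z(2) dual_norm_nonneg[OF normed_space_l2 f]])
    finally have "L * L \<le> nrm (dual (l2 S)) f * L" by (simp add: power2_eq_square)
    moreover have "L \<ge> 0" by (simp add: L_def)
    \<comment> \<open>One factor L cancels unless L = 0, where the claim is nonnegativity of the
      dual norm.\<close>
    ultimately show ?thesis
      using dual_norm_nonneg[OF normed_space_l2 f] unfolding L_def[symmetric]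
      by (cases "L = 0") auto
  qed
  have out: "y s = 0" if "s \<notin> S" for s
    using dual_outside[OF f l2_unit_outside[OF that]] by (simp add: y_def)
  show y: "y \<in> carr (l2 S)" by (rule l2_memI[OF le out])
  show "nrm (l2 S) y \<le> nrm (dual (l2 S)) f" by (rule l2_norm_le[OF le out])
  show "f = l2_functional S y"
  proof (rule l2_dual_eqI[OF f l2_functional_mem[OF y]])
    fix s assume "s \<in> S"
    then have "l2_functional S y (l2_unit s) = y s"
      by (simp add: l2_functional_commute[OF l2_unit_mem y] l2_functional_unit y)
    then show "f (l2_unit s) = l2_functional S y (l2_unit s)" by (simp add: y_def)
  qed
qed

lemma carr_dual_l2: "carr (dual (l2 S)) = l2_predual S"
  unfolding l2_predual_eq using l2_riesz l2_functional_mem by blast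

section \<open>The canonical map into the bidual\<close>

lemma l2_functional_linear: "linear_between (l2 S) (dual (l2 S)) (l2_functional S)"
  by (auto simp: linear_between_def l2_functional_mem)
    (auto simp: fun_eq_iff l2_functional_def l2_pairing_summable infsum_add distrib_left scaleC_apply
      mult.left_commute infsum_cmult_right')

lemma predual_space_l2: "predual_space (l2 S) (l2_predual S) = dual (l2 S)"
  by (simp add: predual_space_def flip: carr_dual_l2)

lemma l2_canonical_map_mem:
  assumes x: "x \<in> carr (l2 S)"
  shows "canonical_map (l2_predual S) x \<in> carr (dual (dual (l2 S)))"
    and "nrm (dual (dual (l2 S))) (canonical_map (l2_predual S) x) \<le> nrm (l2 S) x"
proof -
  have le: "cmod (canonical_map (l2_predual S) x \<phi>) \<le> nrm (l2 S) x * nrm (dual (l2 S)) \<phi>"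
    if "\<phi> \<in> carr (dual (l2 S))" for \<phi>
    using dual_norm_bound[OF normed_space_l2 that x] by (simp add: canonical_map_def l2_norm_nonneg
        dual_norm_nonneg[OF normed_space_l2 that] mult.commute)
  show "canonical_map (l2_predual S) x \<in> carr (dual (dual (l2 S)))"
    by (rule dual_memI[OF _ _ le])
      (simp_all add: canonical_map_def normed_space_add_mem[OF normed_space_dual[OF normed_space_l2]]
        normed_space_scale_mem[OF normed_space_dual[OF normed_space_l2]] scaleC_apply flip: carr_dual_l2)
  show "nrm (dual (dual (l2 S))) (canonical_map (l2_predual S) x) \<le> nrm (l2 S) x"
    by (rule dual_norm_le[OF normed_space_dual[OF normed_space_l2] l2_norm_nonneg le])
qed

text \<open>The coordinate functionals belong to the predual and separate points.\<close>

lemma l2_canonical_map_inj: "inj_on (canonical_map (l2_predual S)) (carr (l2 S))"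
proof (rule inj_onI)
  fix x x' assume x: "x \<in> carr (l2 S)" "x' \<in> carr (l2 S)"
    and eq: "canonical_map (l2_predual S) x = canonical_map (l2_predual S) x'"
  show "x = x'"
  proof
    fix s
    show "x s = x' s"
    proof (cases "s \<in> S")
      case True
      then have "l2_functional S (l2_unit s) \<in> l2_predual S"
        by (simp add: l2_predual_eq l2_unit_mem)
      then show ?thesis
        using fun_cong[OF eq, of "l2_functional S (l2_unit s)"] True x
        by (simp add: canonical_map_def l2_functional_unit)
    qed (simp add: l2_outside[OF x(1)] l2_outside[OF x(2)])
  qed
qed

text \<open>Pulling m back along the map from y to its functional gives a functional on l2(S)
  itself, represented by some x. Symmetry of the pairing then exhibits m as evaluation at x, with
  norms controlled at each stage.\<close>

lemma l2_bidual:
  assumes m: "m \<in> carr (dual (dual (l2 S)))"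
  shows "\<exists>x\<in>carr (l2 S). m = canonical_map (l2_predual S) x \<and> nrm (l2 S) x \<le> nrm (dual (dual (l2 S))) m"
proof -
  note D = normed_space_dual[OF normed_space_l2, of S]
  define g where "g = adjoint (l2 S) (l2_functional S) m"
  have le: "nrm (dual (l2 S)) (l2_functional S y) \<le> 1 * nrm (l2 S) y" if "y \<in> carr (l2 S)" for y
    using l2_functional_norm_le[OF that] by simp
  have g: "g \<in> carr (dual (l2 S))" "nrm (dual (l2 S)) g \<le> nrm (dual (dual (l2 S))) m"
    using adjoint_mem[OF normed_space_l2 D l2_functional_linear zero_le_one le m]
      adjoint_norm_le[OF normed_space_l2 D l2_functional_linear zero_le_one le m]
    by (simp_all add: g_def)
  obtain x where x: "x \<in> carr (l2 S)" "nrm (l2 S) x \<le> nrm (dual (l2 S)) g" "g = l2_functional S x"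
    using l2_riesz[OF g(1)] by blast
  have "m \<phi> = canonical_map (l2_predual S) x \<phi>" for \<phi>
  proof (cases "\<phi> \<in> l2_predual S")
    case True
    then obtain y where y: "y \<in> carr (l2 S)" "\<phi> = l2_functional S y" by (auto simp: l2_predual_eq)
    then have "m \<phi> = l2_functional S x y" using fun_cong[OF x(3), of y] by (simp add: g_def adjoint_def)
    then show ?thesis using True y x(1) by (simp add: canonical_map_def l2_functional_commute)
  next
    case False
    then show ?thesis using dual_outside[OF m] by (simp add: canonical_map_def carr_dual_l2)
  qed
  then show ?thesis using x g by (intro bexI[of _ x]) auto
qed

lemma l2_canonical_map_bij:
  "bij_betw (canonical_map (l2_predual S)) (carr (l2 S)) (carr (dual (predual_space (l2 S) (l2_predual S))))"
  unfolding bij_betw_def predual_space_l2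
  using l2_canonical_map_inj l2_canonical_map_mem(1) l2_bidual by blast

text \<open>\<open>l2_bidual\<close> provides a preimage whose norm is small enough, and injectivity
  identifies it with x.\<close>

lemma l2_canonical_map_norm:
  assumes x: "x \<in> carr (l2 S)"
  shows "nrm (dual (predual_space (l2 S) (l2_predual S))) (canonical_map (l2_predual S) x) = nrm (l2 S) x"
proof -
  obtain x' where "x' \<in> carr (l2 S)" "canonical_map (l2_predual S) x = canonical_map (l2_predual S) x'"
    "nrm (l2 S) x' \<le> nrm (dual (dual (l2 S))) (canonical_map (l2_predual S) x)"
    using l2_bidual[OF l2_canonical_map_mem(1)[OF x]] by blast
  moreover from this have "x = x'" using inj_onD[OF l2_canonical_map_inj] x by blast
  ultimately show ?thesis using l2_canonical_map_mem(2)[OF x] by (simp add: predual_space_l2)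
qed

text \<open>The predual is the entire dual, so it is trivially a closed submodule; reflexivity
  supplies the isometric identification.\<close>

lemma dual_banach_algebra_l2: "dual_banach_algebra (l2 S) (l2_predual S)"
proof -
  have "submodule (l2 S) (dual_bimodule (algebra_bimodule (l2 S))) (l2_predual S)"
    using submodule_whole[OF normed_bimodule_dual[OF normed_space_l2 normed_bimodule_algebra[OF banach_algebra_l2]], of S]
      dual_cong[of "algebra_bimodule (l2 S)" "l2 S"]
    by (simp add: dual_bimodule_def algebra_bimodule_def carr_dual_l2)
  moreover have "closedin (norm_topology (dual (l2 S))) (l2_predual S)"
  proof -
    interpret Metric_space "carr (dual (l2 S))" "norm_dist (dual (l2 S))"
      by (rule Metric_space_norm_dist[OF normed_space_dual[OF normed_space_l2]])
    have "closedin mtopology (carr (dual (l2 S)))"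
      using closedin_topspace[of mtopology] by simp
    then show ?thesis by (simp add: norm_topology_def flip: carr_dual_l2)
  qed
  ultimately show ?thesis
    using banach_algebra_l2 l2_canonical_map_bij l2_canonical_map_norm by (auto simp: dual_banach_algebra_def)
qed

section \<open>Splitting the product morphism\<close>

lemma tensor_form_sum:
  assumes "normed_space E" "normed_space F" "u \<in> carr (proj_tensor E F)"
    and "finite I" "\<And>i. i \<in> I \<Longrightarrow> B i \<in> bilinear_forms E F"
  shows "(\<lambda>x y. \<Sum>i\<in>I. c i * B i x y) \<in> bilinear_forms E F \<and>
    u (\<lambda>x y. \<Sum>i\<in>I. c i * B i x y) = (\<Sum>i\<in>I. c i * u (B i))"
  using assms(4,5)
proof (induction I rule: finite_induct)
  case empty
  have z: "(\<lambda>x y. 0) \<in> bilinear_forms E F"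
    by (rule bilinear_formsI[where K = 0]) simp_all
  then show ?case using tensor_form_scale[OF assms(1-3) z, of 0] by simp
next
  case (insert i I)
  have b: "(\<lambda>x y. c i * B i x y) \<in> bilinear_forms E F"
    using insert by (intro bilinear_forms_scale assms(1,2)) auto
  show ?case
    using insert(1,2) bilinear_forms_add[OF b _ assms(1,2)] tensor_form_add[OF assms(1-3) b]
      tensor_form_scale[OF assms(1-3) insert(4)[of i], of "c i"] insert(3)[OF insert(4)[OF insertI2]]
    by simp
qed

text \<open>The form whose value at a tensor u is the coordinate at s of the product of u.\<close>

definition l2_coord_form :: "'s \<Rightarrow> ('s \<Rightarrow> complex) \<Rightarrow> ('s \<Rightarrow> complex) \<Rightarrow> complex" where
  "l2_coord_form s = (\<lambda>x y. x s * y s)"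

lemma l2_coord_form_mem: "l2_coord_form s \<in> bilinear_forms (l2 S) (l2 S)"
proof (rule bilinear_formsI[where K = 1])
  fix x y assume "x \<in> carr (l2 S)" "y \<in> carr (l2 S)"
  then show "cmod (l2_coord_form s x y) \<le> 1 * nrm (l2 S) x * nrm (l2 S) y"
    by (simp add: l2_coord_form_def norm_mult mult_mono l2_coord_le l2_norm_nonneg)
qed (simp_all add: l2_coord_form_def algebra_simps scaleC_apply)

definition l2_product_map ::
  "'s set \<Rightarrow> ('s \<Rightarrow> complex) tensor_square \<Rightarrow> 's \<Rightarrow> complex" where
  "l2_product_map S u =
     (\<lambda>s. if u \<in> carr (proj_tensor (l2 S) (l2 S)) \<and> s \<in> S then u (l2_coord_form s) else 0)"

text \<open>The same duality argument as in \<open>l2_riesz\<close>, with a bilinear form in place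
  of a test vector. The form is controlled by the Cauchy-Schwarz inequality together with
  submultiplicativity of the norm, since it depends only on the product of its arguments.\<close>

lemma
  assumes u: "u \<in> carr (proj_tensor (l2 S) (l2 S))"
  shows l2_product_map_mem: "l2_product_map S u \<in> carr (l2 S)"
    and l2_product_map_norm_le: "nrm (l2 S) (l2_product_map S u) \<le> nrm (proj_tensor (l2 S) (l2 S)) u"
proof -
  let ?P = "proj_tensor (l2 S) (l2 S)"
  note N = normed_space_l2[of S]
  define w where "w = l2_product_map S u"
  have le: "L2_set (\<lambda>s. cmod (w s)) F \<le> nrm ?P u" if F: "finite F" "F \<subseteq> S" for F
  proof -
    define L where "L = L2_set (\<lambda>s. cmod (w s)) F"
    \<comment> \<open>\<open>B\<close> has norm at most \<open>L\<close> and \<open>u B = L\<^sup>2\<close>.\<close>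
    define B where "B = (\<lambda>x y. \<Sum>s\<in>F. cnj (w s) * l2_coord_form s x y)"
    have B: "B \<in> bilinear_forms (l2 S) (l2 S)" "u B = (\<Sum>s\<in>F. cnj (w s) * u (l2_coord_form s))"
      unfolding B_def using tensor_form_sum[OF N N u F(1), of l2_coord_form "\<lambda>s. cnj (w s)", OF l2_coord_form_mem] by blast+
    have bd: "cmod (B x y) \<le> L * (nrm (l2 S) x * nrm (l2 S) y)" if x: "x \<in> carr (l2 S)" and y: "y \<in> carr (l2 S)" for x y
    proof -
      have "cmod (B x y) \<le> (\<Sum>s\<in>F. cmod (w s) * cmod ((x * y) s))"
        unfolding B_def by (rule order_trans[OF norm_sum]) (simp add: norm_mult l2_coord_form_def)
      also have "\<dots> \<le> L * L2_set (\<lambda>s. cmod ((x * y) s)) F"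
        using L2_set_mult_ineq[of "\<lambda>s. cmod (w s)" "\<lambda>s. cmod ((x * y) s)" F] by (simp add: L_def)
      also have "\<dots> \<le> L * (nrm (l2 S) x * nrm (l2 S) y)"
        using L2_set_le_l2_norm[OF l2_mult(1)[OF x y] F] l2_mult(2)[OF x y]
        by (intro mult_left_mono) (simp_all add: L_def)
      finally show ?thesis .
    qed
    have "u B = (\<Sum>s\<in>F. cnj (w s) * w s)"
      unfolding B(2) using F u by (intro sum.cong) (auto simp: w_def l2_product_map_def)
    also have "\<dots> = complex_of_real (\<Sum>s\<in>F. (cmod (w s))\<^sup>2)"
      by (simp add: complex_norm_square mult.commute flip: of_real_power)
    also have "\<dots> = complex_of_real (L\<^sup>2)" by (simp add: L_def L2_set_def sum_nonneg)
    finally have "L\<^sup>2 \<le> L * nrm ?P u"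
      using tensor_form_bound[OF N N u B(1) _ bd] by (simp add: norm_power L_def)
    then have "L * L \<le> L * nrm ?P u" by (simp add: power2_eq_square)
    moreover have "L \<ge> 0" by (simp add: L_def)
    moreover have "nrm ?P u \<ge> 0" using nrm_nonneg[OF normed_space_proj_tensor[OF N N] u] .
    ultimately show ?thesis unfolding L_def[symmetric] by (cases "L = 0") auto
  qed
  have out: "w s = 0" if "s \<notin> S" for s using that by (simp add: w_def l2_product_map_def)
  show "l2_product_map S u \<in> carr (l2 S)" using l2_memI[OF le out] by (simp add: w_def)
  show "nrm (l2 S) (l2_product_map S u) \<le> nrm ?P u" using l2_norm_le[OF le out] by (simp add: w_def)
qed

lemma l2_product_map_bounded_ops:
  "l2_product_map S \<in> bounded_ops (proj_tensor (l2 S) (l2 S)) (l2 S)"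
proof -
  note P = normed_space_proj_tensor[OF normed_space_l2 normed_space_l2, of S S]
  have "bounded_between (proj_tensor (l2 S) (l2 S)) (l2 S) (l2_product_map S)"
    unfolding bounded_between_def by (rule exI[of _ 1]) (simp add: l2_product_map_norm_le)
  then show ?thesis
    unfolding bounded_ops_iff linear_between_def
    by (auto simp: l2_product_map_mem)
      (auto simp: fun_eq_iff l2_product_map_def normed_space_add_mem[OF P] normed_space_scale_mem[OF P] scaleC_apply)
qed

lemma product_morphism_l2: "product_morphism (l2 S) = l2_product_map S"
  unfolding product_morphism_def
proof (rule tensor_lift_eqI[OF normed_space_l2 normed_space_l2 normed_space_l2 l2_product_map_bounded_ops])
  fix x y assume xy: "x \<in> carr (l2 S)" "y \<in> carr (l2 S)"
  then show "l2_product_map S (elem_tensor (l2 S) (l2 S) x y) = mult (l2 S) x y"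
    using elem_tensor_mem[OF normed_space_l2 normed_space_l2 xy] l2_coord_form_mem[of _ S]
    by (auto simp: fun_eq_iff l2_product_map_def elem_tensor_def mult_l2 l2_coord_form_def l2_outside)
qed

abbreviation l2_tensor :: "'s set \<Rightarrow> ('s \<Rightarrow> complex) tensor_square nspace" where
  "l2_tensor S \<equiv> proj_tensor (l2 S) (l2 S)"

abbreviation l2_forms :: "'s set \<Rightarrow> ('s \<Rightarrow> complex, ('s \<Rightarrow> complex) tensor_square \<Rightarrow> complex) bimodule" where
  "l2_forms S \<equiv> dual_bimodule (tensor_bimodule (l2 S))"

definition l2_diag :: "'s set \<Rightarrow> 's \<Rightarrow> ('s \<Rightarrow> complex) tensor_square" where
  "l2_diag S s = elem_tensor (l2 S) (l2 S) (l2_unit s) (l2_unit s)"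

lemma carr_l2_forms: "carr (l2_forms S) = carr (dual (l2_tensor S))"
  and nrm_l2_forms: "nrm (l2_forms S) = nrm (dual (l2_tensor S))"
  by (simp_all add: dual_bimodule_def dual_tensor_bimodule[OF banach_algebra_l2])

lemma dual_l2_forms: "dual (l2_forms S) = dual (dual (l2_tensor S))"
  by (rule dual_cong[OF carr_l2_forms nrm_l2_forms])

lemma normed_bimodule_l2_tensor: "normed_bimodule (l2 S) (tensor_bimodule (l2 S))"
  by (rule normed_bimodule_tensor[OF banach_algebra_l2])

lemma normed_bimodule_l2_forms: "normed_bimodule (l2 S) (l2_forms S)"
  by (rule normed_bimodule_dual[OF normed_space_l2 normed_bimodule_l2_tensor])

lemma normed_space_l2_tensor: "normed_space (l2_tensor S)"
  by (rule normed_space_proj_tensor[OF normed_space_l2 normed_space_l2])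

lemma sigma_wc_bidual_l2: "sigma_wc_bidual (l2 S) (l2_predual S) = dual_bimodule (l2_forms S)"
  by (rule sigma_wc_bidual_reflexive[OF banach_algebra_l2 carr_dual_l2[symmetric]])

lemma carr_l2_bidual: "carr (dual_bimodule (l2_forms S)) = carr (dual (dual (l2_tensor S)))"
  and nrm_l2_bidual: "nrm (dual_bimodule (l2_forms S)) = nrm (dual (dual (l2_tensor S)))"
  by (simp_all add: dual_bimodule_def[of "l2_forms S"] dual_l2_forms)

lemma pi_sigma_wc_l2_iff:
  assumes "m \<in> carr (dual (dual (l2_tensor S)))" "a \<in> carr (l2 S)"
  shows "pi_sigma_wc (l2 S) (l2_predual S) m = a \<longleftrightarrow>
    (\<forall>\<phi>\<in>l2_predual S. m (adjoint (tensor_bimodule (l2 S)) (l2_product_map S) \<phi>) = \<phi> a)"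
  using pi_sigma_wc_eq_iff[OF banach_algebra_l2 carr_dual_l2[symmetric] l2_canonical_map_bij _ assms]
  by (simp add: product_morphism_l2 l2_product_map_bounded_ops)

section \<open>Diagonal tensors and the approximate splitting\<close>

lemma l2_diag_mem: "s \<in> S \<Longrightarrow> l2_diag S s \<in> carr (l2_tensor S)"
  unfolding l2_diag_def by (intro elem_tensor_mem normed_space_l2 l2_unit_mem)

lemma l2_mult_unit: "a * l2_unit s = a s *\<^sub>C l2_unit s"
  by (auto simp: fun_eq_iff l2_unit_def scaleC_apply)

lemma lact_l2_diag: "s \<in> S \<Longrightarrow> a \<in> carr (l2 S) \<Longrightarrow> lact (tensor_bimodule (l2 S)) a (l2_diag S s) = a s *\<^sub>C l2_diag S s"
  by (simp add: l2_diag_def lact_elem_tensor[OF banach_algebra_l2] l2_unit_mem mult_l2 l2_mult_unit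
      elem_tensor_scale_left)

lemma ract_l2_diag: "s \<in> S \<Longrightarrow> a \<in> carr (l2 S) \<Longrightarrow> ract (tensor_bimodule (l2 S)) (l2_diag S s) a = a s *\<^sub>C l2_diag S s"
  by (simp add: l2_diag_def ract_elem_tensor[OF banach_algebra_l2] l2_unit_mem mult_l2
      mult.commute[of "l2_unit s"] l2_mult_unit elem_tensor_scale_right)

lemma l2_product_map_diag: "s \<in> S \<Longrightarrow> l2_product_map S (l2_diag S s) = l2_unit s"
  using l2_diag_mem[of s S] l2_coord_form_mem[of _ S]
  by (auto simp: fun_eq_iff l2_product_map_def l2_diag_def elem_tensor_def l2_coord_form_def l2_unit_def)

text \<open>Already composed with the embedding into the bidual: the functional is evaluation at the
  sum of a(s) e_s \<otimes> e_s over F.\<close>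

definition l2_rho ::
  "'s set \<Rightarrow> 's set \<Rightarrow> ('s \<Rightarrow> complex) \<Rightarrow> (('s \<Rightarrow> complex) tensor_square \<Rightarrow> complex) \<Rightarrow> complex" where
  "l2_rho S F a = (\<lambda>f. if f \<in> carr (dual (l2_tensor S)) then \<Sum>s\<in>F. a s * f (l2_diag S s) else 0)"

text \<open>A crude constant that may grow with F is enough: each morphism has to be continuous, but
  approximate Connes-biprojectivity asks for no bound uniform in the net.\<close>

lemma
  assumes F: "finite F" "F \<subseteq> S" and a: "a \<in> carr (l2 S)"
  shows l2_rho_mem: "l2_rho S F a \<in> carr (dual (dual (l2_tensor S)))"
    and l2_rho_norm_le: "nrm (dual (dual (l2_tensor S))) (l2_rho S F a) \<le>
      (\<Sum>s\<in>F. nrm (l2_tensor S) (l2_diag S s)) * nrm (l2 S) a"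
proof -
  note T = normed_space_l2_tensor[of S]
  note D = normed_space_dual[OF T]
  let ?K = "\<Sum>s\<in>F. nrm (l2_tensor S) (l2_diag S s)"
  have le: "cmod (l2_rho S F a f) \<le> (?K * nrm (l2 S) a) * nrm (dual (l2_tensor S)) f"
    if f: "f \<in> carr (dual (l2_tensor S))" for f
  proof -
    have "cmod (l2_rho S F a f) \<le> (\<Sum>s\<in>F. cmod (a s) * cmod (f (l2_diag S s)))"
      unfolding l2_rho_def using f by (simp add: order_trans[OF norm_sum] norm_mult)
    also have "\<dots> \<le> (\<Sum>s\<in>F. nrm (l2 S) a * (nrm (dual (l2_tensor S)) f * nrm (l2_tensor S) (l2_diag S s)))"
      using F by (intro sum_mono mult_mono l2_coord_le[OF a] dual_norm_bound[OF T f] l2_diag_mem l2_norm_nonneg) auto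
    also have "\<dots> = (?K * nrm (l2 S) a) * nrm (dual (l2_tensor S)) f"
      by (simp add: sum_distrib_left sum_distrib_right mult_ac)
    finally show ?thesis .
  qed
  have K: "?K * nrm (l2 S) a \<ge> 0"
    using F by (intro mult_nonneg_nonneg sum_nonneg nrm_nonneg[OF T] l2_diag_mem l2_norm_nonneg) auto
  show "l2_rho S F a \<in> carr (dual (dual (l2_tensor S)))"
    by (rule dual_memI[OF _ _ le])
      (simp_all add: l2_rho_def normed_space_add_mem[OF D] normed_space_scale_mem[OF D] scaleC_apply
        distrib_left sum.distrib sum_distrib_left mult.left_commute)
  show "nrm (dual (dual (l2_tensor S))) (l2_rho S F a) \<le> ?K * nrm (l2 S) a"
    by (rule dual_norm_le[OF D K le])
qed

text \<open>Because a e_s = a(s) e_s, both actions of a multiply e_s \<otimes> e_s by the same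
  scalar a(s), and so does replacing x by its product with a.\<close>

lemma l2_rho_morphism:
  assumes F: "finite F" "F \<subseteq> S"
  shows "bimodule_morphism (l2 S) (algebra_bimodule (l2 S)) (dual_bimodule (l2_forms S)) (l2_rho S F)"
proof -
  have act: "lact (l2_forms S) a f \<in> carr (l2_forms S)" "ract (l2_forms S) f a \<in> carr (l2_forms S)"
    if "a \<in> carr (l2 S)" "f \<in> carr (l2_forms S)" for a f
    using normed_bimodule_l2_forms[of S] that by (auto simp: normed_bimodule_def dest: linear_between_mem)
  have diag: "lact (l2_forms S) a f (l2_diag S s) = a s * f (l2_diag S s)"
    "ract (l2_forms S) f a (l2_diag S s) = a s * f (l2_diag S s)"
    if "a \<in> carr (l2 S)" "f \<in> carr (dual (l2_tensor S))" "s \<in> S" for a f s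
    using that l2_diag_mem[OF that(3)]
    by (simp_all add: dual_bimodule_def carr_tensor_bimodule[OF banach_algebra_l2] lact_l2_diag ract_l2_diag
        dual_scale[OF that(2)])
  have l: "l2_rho S F (a * x) = lact (dual_bimodule (l2_forms S)) a (l2_rho S F x)"
    and r: "l2_rho S F (x * a) = ract (dual_bimodule (l2_forms S)) (l2_rho S F x) a"
    if "a \<in> carr (l2 S)" "x \<in> carr (l2 S)" for a x
    using act[OF that(1)] diag[OF that(1)] F(2)
    by (auto simp: fun_eq_iff l2_rho_def dual_bimodule_def[of "l2_forms S"] carr_l2_forms mult_ac intro!: sum.cong)
  have "linear_between (l2 S) (dual (dual (l2_tensor S))) (l2_rho S F)"
    using l2_rho_mem[OF F]
    by (auto simp: linear_between_def fun_eq_iff l2_rho_def scaleC_apply distrib_right sum.distrib sum_distrib_left mult.assoc)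
  then show ?thesis
    using l r by (simp add: bimodule_morphism_def algebra_bimodule_def mult_l2 linear_between_def carr_l2_bidual)
qed

text \<open>Tested against \<phi>, a diagonal tensor contributes \<open>\<phi> (l2_unit s)\<close>,
  because its product is the unit vector; linearity of \<phi> assembles the truncation.\<close>

lemma pi_l2_rho:
  assumes F: "finite F" "F \<subseteq> S" and a: "a \<in> carr (l2 S)"
  shows "pi_sigma_wc (l2 S) (l2_predual S) (l2_rho S F a) = l2_restrict F a"
  unfolding pi_sigma_wc_l2_iff[OF l2_rho_mem[OF F a] l2_restrict_mem[OF F]]
proof
  fix \<phi> assume "\<phi> \<in> l2_predual S"
  then have \<phi>: "\<phi> \<in> carr (dual (l2 S))" by (simp add: carr_dual_l2)
  then have lin: "linear_between (l2 S) complex_space \<phi>" by (simp add: carr_dual_iff)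
  let ?f = "adjoint (tensor_bimodule (l2 S)) (l2_product_map S) \<phi>"
  have eq: "?f = adjoint (l2_tensor S) (l2_product_map S) \<phi>"
    by (simp add: adjoint_def carr_tensor_bimodule[OF banach_algebra_l2])
  have f: "?f \<in> carr (dual (l2_tensor S))"
    unfolding eq using l2_product_map_bounded_ops[of S] l2_product_map_norm_le[of _ S]
    by (intro adjoint_mem[OF normed_space_l2_tensor normed_space_l2 _ zero_le_one _ \<phi>])
      (auto simp: bounded_ops_iff)
  have "l2_rho S F a ?f = (\<Sum>s\<in>F. a s * \<phi> (l2_unit s))"
    unfolding eq using f[unfolded eq] F by (auto simp: l2_rho_def adjoint_def l2_diag_mem l2_product_map_diag subset_iff intro!: sum.cong)
  also have "\<dots> = (\<Sum>s\<in>F. \<phi> (a s *\<^sub>C l2_unit s))"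
    using F by (intro sum.cong) (auto simp: dual_scale[OF \<phi>] l2_unit_mem subset_iff)
  also have "\<dots> = \<phi> (l2_restrict F a)"
    unfolding l2_restrict_sum[OF F(1)]
    using F by (intro linear_between_sum[OF lin normed_space_l2, symmetric]
        normed_space_scale_mem[OF normed_space_l2] l2_unit_mem) auto
  finally show "l2_rho S F a ?f = \<phi> (l2_restrict F a)" .
qed

text \<open>The net is indexed by the finite subsets of S under inclusion; its filter is the image
  of \<open>finite_subsets_at_top S\<close>.\<close>

lemma approx_connes_biprojective_l2: "approx_connes_biprojective (l2 S) (l2_predual S)"
  unfolding approx_connes_biprojective_def sigma_wc_bidual_l2
proof (intro exI conjI ballI)
  let ?F = "filtermap (l2_rho S) (finite_subsets_at_top S)"
  show "?F \<noteq> bot" by (simp add: filtermap_bot_iff)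
  have cont: "continuous_map (norm_topology (l2 S)) (norm_topology (dual_bimodule (l2_forms S))) (l2_rho S F)"
    if F: "finite F" "F \<subseteq> S" for F
  proof (rule bounded_linear_continuous_map[OF normed_space_l2])
    show "normed_space (dual_bimodule (l2_forms S))"
      using normed_bimodule_dual[OF normed_space_l2 normed_bimodule_l2_forms[of S]] by (simp add: normed_bimodule_def)
    show "linear_between (l2 S) (dual_bimodule (l2_forms S)) (l2_rho S F)"
      using l2_rho_morphism[OF F] by (simp add: bimodule_morphism_def linear_between_def algebra_bimodule_def)
    show "bounded_between (l2 S) (dual_bimodule (l2_forms S)) (l2_rho S F)"
      using l2_rho_norm_le[OF F] by (auto simp: bounded_between_def nrm_l2_bidual)
  qed
  show "\<forall>\<^sub>F \<rho> in ?F. bimodule_morphism (l2 S) (algebra_bimodule (l2 S)) (dual_bimodule (l2_forms S)) \<rho> \<and>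
      continuous_map (norm_topology (l2 S)) (norm_topology (dual_bimodule (l2_forms S))) \<rho>"
    unfolding eventually_filtermap
    by (rule eventually_finite_subsets_at_top_weakI) (use l2_rho_morphism cont in blast)
  fix a assume a: "a \<in> carr (l2 S)"
  have "\<forall>\<^sub>F F in finite_subsets_at_top S.
      nrm (l2 S) (pi_sigma_wc (l2 S) (l2_predual S) (l2_rho S F a) - a) = nrm (l2 S) (l2_restrict F a - a)"
    by (rule eventually_finite_subsets_at_top_weakI) (simp add: pi_l2_rho a)
  then show "((\<lambda>\<rho>. nrm (l2 S) (pi_sigma_wc (l2 S) (l2_predual S) (\<rho> a) - a)) \<longlongrightarrow> 0) ?F"
    using l2_restrict_tendsto[OF a] by (simp add: filterlim_filtermap tendsto_cong)
qed

section \<open>The obstruction to an exact bounded splitting\<close>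

text \<open>Evaluated at a form B, the left side is u at the form with values B(e_s x, y e_s) = x(s)
  y(s) B(e_s, e_s), a scalar multiple of the coordinate form.\<close>

lemma l2_compress:
  assumes s: "s \<in> S" and u: "u \<in> carr (l2_tensor S)"
  shows "lact (tensor_bimodule (l2 S)) (l2_unit s) (ract (tensor_bimodule (l2 S)) u (l2_unit s)) =
    u (l2_coord_form s) *\<^sub>C l2_diag S s"
proof
  fix B :: "('a \<Rightarrow> complex) \<Rightarrow> ('a \<Rightarrow> complex) \<Rightarrow> complex"
  note A = banach_algebra_l2[of S] and N = normed_space_l2[of S] and e = l2_unit_mem[OF s]
  let ?T = "tensor_bimodule (l2 S)"
  \<comment> \<open>\<open>tensor_map\<close> is 0 off the carrier, so the inner action must be
    known to yield a tensor before the outer one can be unfolded.\<close>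
  have v: "ract ?T u (l2_unit s) \<in> carr (l2_tensor S)"
    using normed_bimodule_l2_tensor[of S] u e linear_between_mem
    by (fastforce simp: normed_bimodule_def carr_tensor_bimodule[OF A])
  show "lact ?T (l2_unit s) (ract ?T u (l2_unit s)) B = (u (l2_coord_form s) *\<^sub>C l2_diag S s) B"
  proof (cases "B \<in> bilinear_forms (l2 S) (l2 S)")
    case True
    have unit: "l2_unit s * x = x s *\<^sub>C l2_unit s" for x :: "'a \<Rightarrow> complex"
      by (simp add: mult.commute[of "l2_unit s"] l2_mult_unit)
    have "bounded_between (l2 S) (l2 S) (mult (l2 S) (l2_unit s))"
      unfolding bounded_between_def
      by (rule exI[of _ "nrm (l2 S) (l2_unit s)"]) (simp add: banach_mult_norm[OF A e])
    moreover have "bounded_between (l2 S) (l2 S) (\<lambda>y. y)"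
      unfolding bounded_between_def by (rule exI[of _ 1]) simp
    ultimately have B': "(\<lambda>x y. B (l2_unit s * x) y) \<in> bilinear_forms (l2 S) (l2 S)"
      using bilinear_forms_compose[OF True N N N N banach_mult_left[OF A e] _ linear_between_id]
      by (simp add: mult_l2)
    have "lact ?T (l2_unit s) (ract ?T u (l2_unit s)) B = u (\<lambda>x y. B (l2_unit s * x) (y * l2_unit s))"
      using v True u B'
      by (simp add: lact_tensor_bimodule[OF A e] ract_tensor_bimodule[OF A e] tensor_map_def mult_l2)
    also have "\<dots> = u (\<lambda>x y. B (l2_unit s) (l2_unit s) * l2_coord_form s x y)"
      by (rule tensor_form_cong[OF N N u])
        (simp add: unit l2_mult_unit bilinear_forms_scale_left[OF True] bilinear_forms_scale_right[OF True]
          normed_space_scale_mem[OF N] e l2_coord_form_def mult_ac)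
    also have "\<dots> = B (l2_unit s) (l2_unit s) * u (l2_coord_form s)"
      by (rule tensor_form_scale[OF N N u l2_coord_form_mem])
    finally show ?thesis using True by (simp add: scaleC_apply l2_diag_def elem_tensor_def)
  next
    case False
    then show ?thesis
      by (simp add: lact_tensor_bimodule[OF A e] tensor_map_def scaleC_apply l2_diag_def elem_tensor_def)
  qed
qed

text \<open>Compression by e_s leaves only one degree of freedom for the image of e_s, and the
  splitting condition fixes it.\<close>

lemma l2_splitting_unit:
  assumes mor: "bimodule_morphism (l2 S) (algebra_bimodule (l2 S)) (dual_bimodule (l2_forms S)) \<rho>"
    and split: "pi_sigma_wc (l2 S) (l2_predual S) (\<rho> (l2_unit s)) = l2_unit s"
    and s: "s \<in> S" and f: "f \<in> carr (dual (l2_tensor S))"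
  shows "\<rho> (l2_unit s) f = f (l2_diag S s)"
proof -
  let ?e = "l2_unit s" and ?T = "tensor_bimodule (l2 S)"
  note e = l2_unit_mem[OF s] and A = banach_algebra_l2[of S]
  define m where "m = \<rho> ?e"
  have m: "m \<in> carr (dual (dual (l2_tensor S)))"
    using mor e by (auto simp: m_def bimodule_morphism_def linear_between_def algebra_bimodule_def carr_l2_bidual)
  \<comment> \<open>Idempotence allows the morphism property to be used with e_s both as acting
    element and as argument, so that \<open>m\<close> is fixed by both actions.\<close>
  have ee: "?e * ?e = ?e" by (auto simp: l2_unit_def fun_eq_iff)
  have ml: "m = lact (dual_bimodule (l2_forms S)) ?e m" and mr: "m = ract (dual_bimodule (l2_forms S)) m ?e"
    using mor e by (auto simp: m_def bimodule_morphism_def algebra_bimodule_def mult_l2 dest!: bspec[OF _ e] simp: ee)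
  have f': "f \<in> carr (l2_forms S)" using f by (simp add: carr_l2_forms)
  have fr: "ract (l2_forms S) f ?e \<in> carr (l2_forms S)"
    using normed_bimodule_l2_forms[of S] e f' linear_between_mem by (fastforce simp: normed_bimodule_def)
  define h where "h = lact (l2_forms S) ?e (ract (l2_forms S) f ?e)"
  \<comment> \<open>The coordinate functional at s pulled back along the product morphism.\<close>
  define g where "g = adjoint ?T (l2_product_map S) (l2_functional S ?e)"
  have fe: "l2_functional S ?e \<in> carr (dual (l2 S))" by (rule l2_functional_mem[OF e])
  \<comment> \<open>On the bidual the left action precomposes with f |-> f . e_s and the right
    action with f |-> e_s . f, so the two fixed-point equations insert e_s on one side at a
    time.\<close>
  have "m f = m (ract (l2_forms S) f ?e)"
    using fun_cong[OF ml, of f] f' by (simp add: dual_bimodule_def[of "l2_forms S"])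
  also have "\<dots> = m h"
    using fun_cong[OF mr, of "ract (l2_forms S) f ?e"] fr by (simp add: dual_bimodule_def[of "l2_forms S"] h_def)
  also have "h = f (l2_diag S s) *\<^sub>C g"
  proof
    fix u
    show "h u = (f (l2_diag S s) *\<^sub>C g) u"
    proof (cases "u \<in> carr (l2_tensor S)")
      case True
      have v: "ract ?T u ?e \<in> carr (l2_tensor S)"
        using normed_bimodule_l2_tensor[of S] True e linear_between_mem
        by (fastforce simp: normed_bimodule_def carr_tensor_bimodule[OF A])
      have "h u = f (lact ?T ?e (ract ?T u ?e))"
        using True v by (simp add: h_def dual_bimodule_def carr_tensor_bimodule[OF A])
      also have "\<dots> = u (l2_coord_form s) * f (l2_diag S s)"
        by (simp add: l2_compress[OF s True] dual_scale[OF f l2_diag_mem[OF s]])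
      also have "u (l2_coord_form s) = g u"
        using True s l2_product_map_mem[OF True]
        by (simp add: g_def adjoint_def carr_tensor_bimodule[OF A] l2_functional_unit)
          (simp add: l2_product_map_def)
      finally show ?thesis by (simp add: scaleC_apply)
    qed (simp add: h_def g_def adjoint_def dual_bimodule_def scaleC_apply carr_tensor_bimodule[OF A])
  qed
  also have "m \<dots> = f (l2_diag S s) * m g"
  proof -
    have "adjoint (l2_tensor S) (l2_product_map S) (l2_functional S ?e) \<in> carr (dual (l2_tensor S))"
      using l2_product_map_bounded_ops[of S] l2_product_map_norm_le[of _ S]
      by (intro adjoint_mem[OF normed_space_l2_tensor normed_space_l2 _ zero_le_one _ fe])
        (auto simp: bounded_ops_iff)
    then have "g \<in> carr (dual (l2_tensor S))" by (simp add: g_def adjoint_def carr_tensor_bimodule[OF A])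
    then show ?thesis by (rule dual_scale[OF m])
  qed
  \<comment> \<open>This is the splitting condition tested against the coordinate
    functional.\<close>
  also have "m g = l2_functional S ?e ?e"
    using pi_sigma_wc_l2_iff[OF m e] split fe unfolding g_def m_def by (simp add: carr_dual_l2)
  also have "\<dots> = 1" using l2_functional_unit[OF s e] by (simp add: l2_unit_def)
  finally show ?thesis by (simp add: m_def)
qed

lemma not_connes_biprojective_l2:
  fixes S :: "'s set"
  assumes "infinite S"
  shows "\<not> connes_biprojective (l2 S) (l2_predual S)"
proof
  assume "connes_biprojective (l2 S) (l2_predual S)"
  then obtain \<rho> where mor: "bimodule_morphism (l2 S) (algebra_bimodule (l2 S)) (dual_bimodule (l2_forms S)) \<rho>"
    and bd: "bounded_between (l2 S) (dual_bimodule (l2_forms S)) \<rho>"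
    and split: "\<And>a. a \<in> carr (l2 S) \<Longrightarrow> pi_sigma_wc (l2 S) (l2_predual S) (\<rho> a) = a"
    by (auto simp: connes_biprojective_def sigma_wc_bidual_l2)
  note N = normed_space_l2[of S] and D = normed_space_dual[OF normed_space_l2_tensor, of S]
  have lin: "linear_between (l2 S) (dual_bimodule (l2_forms S)) \<rho>"
    using mor by (simp add: bimodule_morphism_def linear_between_def algebra_bimodule_def)
  obtain K where K: "K \<ge> 0" "\<And>x. x \<in> carr (l2 S) \<Longrightarrow> nrm (dual_bimodule (l2_forms S)) (\<rho> x) \<le> K * nrm (l2 S) x"
    using bounded_betweenE[OF bd N] by blast
  \<comment> \<open>Expressed through \<open>l2_functional\<close>, the pairing is linear in x
    because functionals are, and linear in y by \<open>l2_functional_linear\<close>; the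
    Cauchy-Schwarz inequality gives the constant 1.\<close>
  define B where "B = (\<lambda>x y. l2_functional S y x)"
  have B: "B \<in> bilinear_forms (l2 S) (l2 S)"
  proof (rule bilinear_formsI[where K = 1])
    fix x y assume x: "x \<in> carr (l2 S)" and y: "y \<in> carr (l2 S)"
    show "cmod (B x y) \<le> 1 * nrm (l2 S) x * nrm (l2 S) y"
      using l2_pairing_bound[OF x y] x by (simp add: B_def l2_functional_def)
  qed (simp_all add: B_def linear_between_add[OF l2_functional_linear] linear_between_scale[OF l2_functional_linear]
      dual_add[OF l2_functional_mem] dual_scale[OF l2_functional_mem] scaleC_apply)
  define f where "f = tensor_functional (l2 S) (l2 S) B"
  have f: "f \<in> carr (dual (l2_tensor S))" unfolding f_def by (rule tensor_functional_mem[OF N N B])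
  have fd: "f (l2_diag S s) = 1" if "s \<in> S" for s
    using l2_diag_mem[OF that] B l2_functional_unit[OF that l2_unit_mem[OF that]]
    by (simp add: f_def tensor_functional_def) (simp add: l2_diag_def elem_tensor_def B_def l2_unit_def)
  \<comment> \<open>Independent of F, which is what makes the comparison below contradictory for
    large F.\<close>
  define C where "C = K * nrm (dual (l2_tensor S)) f"
  have card: "real (card F) \<le> C * sqrt (card F)" if F: "finite F" "F \<subseteq> S" for F
  proof -
    \<comment> \<open>The indicator of F: \<open>\<rho> x f\<close> counts the elements of F,
      whereas the norm of x is at most the square root of that number.\<close>
    define x :: "'s \<Rightarrow> complex" where "x = l2_restrict F (\<lambda>_. 1)"
    have x: "x \<in> carr (l2 S)" "nrm (l2 S) x \<le> sqrt (card F)"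
      using l2_restrict_mem[OF F] l2_restrict_norm_le[OF F, of "\<lambda>_. 1"] by (simp_all add: x_def L2_set_constant)
    have rx: "\<rho> x \<in> carr (dual (dual (l2_tensor S)))"
      using linear_between_mem[OF lin x(1)] by (simp add: carr_l2_bidual)
    have xs: "x = (\<Sum>s\<in>F. l2_unit s)" by (simp add: x_def l2_restrict_sum[OF F(1)] scaleC_one)
    have ap: "(\<Sum>s\<in>G. \<rho> (l2_unit s)) f = (\<Sum>s\<in>G. \<rho> (l2_unit s) f)" for G :: "'s set"
      by (induction G rule: infinite_finite_induct) simp_all
    have "\<rho> x = (\<Sum>s\<in>F. \<rho> (l2_unit s))"
      unfolding xs using F by (intro linear_between_sum[OF lin N] l2_unit_mem) auto
    then have "\<rho> x f = (\<Sum>s\<in>F. 1)"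
      unfolding ap[symmetric] using F
      by (simp add: ap l2_splitting_unit[OF mor split[OF l2_unit_mem] _ f] fd subset_iff)
    then have "real (card F) = cmod (\<rho> x f)" by simp
    also have "\<dots> \<le> nrm (dual (dual (l2_tensor S))) (\<rho> x) * nrm (dual (l2_tensor S)) f"
      by (rule dual_norm_bound[OF D rx f])
    also have "\<dots> \<le> (K * nrm (l2 S) x) * nrm (dual (l2_tensor S)) f"
      using K(2)[OF x(1)] by (intro mult_right_mono dual_norm_nonneg[OF normed_space_l2_tensor f]) (simp add: nrm_l2_bidual)
    also have "\<dots> \<le> (K * sqrt (card F)) * nrm (dual (l2_tensor S)) f"
      using x(2) K(1) by (intro mult_right_mono mult_left_mono dual_norm_nonneg[OF normed_space_l2_tensor f])
    finally show ?thesis by (simp add: C_def mult_ac)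
  qed
  \<comment> \<open>The bound to be refuted is \<open>sqrt n \<le> C\<close>. As
    \<open>C\<^sup>2\<close> is nonnegative, the choice also gives n > 0, so a factor
    \<open>sqrt n\<close> can be cancelled.\<close>
  obtain n :: nat where n: "C\<^sup>2 < n" using reals_Archimedean2 by blast
  obtain F where F: "finite F" "card F = n" "F \<subseteq> S"
    using infinite_arbitrarily_large[OF assms] by blast
  have n0: "sqrt n > 0" using n by (smt (verit) zero_le_power2 real_sqrt_gt_zero)
  have "sqrt n * sqrt n \<le> C * sqrt n" using card[OF F(1,3)] F(2) by simp
  then have "sqrt n \<le> C" using n0 by (rule mult_right_le_imp_le)
  then have "(sqrt n)\<^sup>2 \<le> C\<^sup>2" using n0 by (intro power_mono) auto
  then show False using n by simp
qed

theorem theorem4p2: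
  fixes S :: "'s set"
  assumes "infinite S"
  shows "dual_banach_algebra (l2 S) (l2_predual S) \<and>
         approx_connes_biprojective (l2 S) (l2_predual S) \<and>
         \<not> connes_biprojective (l2 S) (l2_predual S)"
  using dual_banach_algebra_l2 approx_connes_biprojective_l2 not_connes_biprojective_l2[OF assms] by blast

end
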